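(* Assume that the constant function $1$ belongs to $V_h^{2,c}$ and the constant vector fields $\mathbf e_1,\mathbf e_2$ belong to $V_h^{1,c}$. Let $\Delta t>0$, $\nu\ge0$, $\alpha\ge 0$, and let $\mathbf u_h^0\in V_h^{1,c}$ with $\operatorname{div}(\mathbf u_h^0)=0$. Let $(\mathbf u_h^{n})_{n\ge0}\subset V_h^{1,c}$ and $(p_h^{n})_{n\ge1}\subset V_h^{2,c}$ be such that for every $n\ge0$, with $\mathbf u_h^{n+\frac12}:=\frac12(\mathbf u_h^{n+1}+\mathbf u_h^n)$, the Crank--Nicolson system $$\int_\Omega\frac{\mathbf u_h^{n+1}-\mathbf u_h^n}{\Delta t}\cdot\mathbf v_h+\int_\Omega\mathbf u_h^{n+\frac12}\cdot s_h(\mathbf u_h^{n+\frac12},\mathbf v_h)+\int_\Omega\widetilde{\mathrm{grad}}_h\,p_h^{n+1}\cdot\mathbf v_h+\nu\int_\Omega(\widetilde{\mathrm{curl}}_h\,\mathbf u_h^{n+\frac12})(\widetilde{\mathrm{curl}}_h\,\mathbf v_h)+\alpha\int_\Omega(I-P_1^c)\mathbf u_h^{n+\frac12}\cdot(I-P_1^c)\mathbf v_h=0,$$ $$\int_\Omega\mathbf u_h^{n+\frac12}\cdot s_h(\mathbf u_h^{n+\frac12},\widetilde{\mathrm{grad}}_h\,q_h)+\int_\Omega\widetilde{\mathrm{grad}}_h\,p_h^{n+1}\cdot\widetilde{\mathrm{grad}}_h\,q_h=0$$ holds for all $\mathbf v_h\in V_h^{1,c}$ and $q_h\in V_h^{2,c}$.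 Then the momentum is preserved: for all $n\ge0$, $$\frac1{\Delta t}\Big(\int_\Omega\mathbf u_h^{n+1}-\int_\Omega\mathbf u_h^n\Big)=0.$$
   Context: Setting (dimension $d=2$). $\Omega$ is a two-dimensional domain with either periodic boundary conditions (a rectangle with opposite sides identified; all function spaces are spaces of periodic functions: $V^0=H^1(\Omega)$, $V^1=H(\mathrm{div};\Omega)$, $V^2=L^2(\Omega)$) or homogeneous boundary conditions on a bounded Lipschitz domain ($V^0=H^1_0(\Omega)$, $V^1=H_0(\mathrm{div};\Omega)$, $V^2=L^2(\Omega)$). For scalar $\omega$, $\operatorname{curl}\omega=(\partial_2\omega,-\partial_1\omega)$. Discrete spaces: $V_h^{\ell,c}\subset V^\ell$, $\ell=0,1,2$, are finite-dimensional (finite element) spaces of bounded functions with $\operatorname{curl}V_h^{0,c}\subset V_h^{1,c}$ and $\operatorname{div}V_h^{1,c}\subset V_h^{2,c}$. $P_1^c$ is a projection with range $V_h^{1,c}$ defined on a (possibly larger) broken space $V_h^1\supset V_h^{1,c}$; in particular $P_1^c\mathbf v_h=\mathbf v_h$ for $\mathbf v_h\in V_h^{1,c}$. Discrete dual operators: $\widetilde{\mathrm{grad}}_h:V_h^{2,c}\to V_h^{1,c}$ and $\widetilde{\mathrm{curl}}_h:V_h^{1,c}\to V_h^{0,c}$ are defined by $\int_\Omega \widetilde{\mathrm{grad}}_h q_h\cdot\mathbf v_h=-\int_\Omega q_h\operatorname{div}\mathbf v_h$ and $\int_\Omega(\widetilde{\mathrm{curl}}_h\mathbf v_h)\,\omega_h=\int_\Omega\mathbf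 v_h\cdot\operatorname{curl}\omega_h$ for all $q_h\in V_h^{2,c}$, $\mathbf v_h\in V_h^{1,c}$, $\omega_h\in V_h^{0,c}$. For $\mathbf a\in\mathbb R^2$, $\tilde\imath^{0h}_{\mathbf a}\mathbf u_h=\tilde P_h^0(\mathbf a\cdot\mathbf u_h)$, with $\tilde P_h^0$ the $L^2$-orthogonal projection onto $V_h^{2,c}$. With $\mathbf e_1,\mathbf e_2$ the canonical basis and $P_h^1$ the $L^2$-orthogonal projection onto $V_h^{1,c}$, $$s_h(\mathbf u_h,\mathbf v_h)=\tfrac12P_h^1\Big(\sum_{k=1}^{2}(\tilde\imath^{0h}_{\mathbf e_k}\mathbf v_h)\,\widetilde{\mathrm{grad}}_h(\tilde\imath^{0h}_{\mathbf e_k}\mathbf u_h)-(\tilde\imath^{0h}_{\mathbf e_k}\mathbf u_h)\,\widetilde{\mathrm{grad}}_h(\tilde\imath^{0h}_{\mathbf e_k}\mathbf v_h)\Big).$$ *)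

theory Defs
  imports "HOL-Analysis.Analysis"
begin

text \<open>
  Elements of Lebesgue and Sobolev spaces are represented by functions on the plane whose values
  outside \<open>\<Omega>\<close> are irrelevant; every subspace below is closed under almost-everywhere equality on
  \<open>\<Omega>\<close>, so membership and all operators are meaningful for equivalence classes.
\<close>

text \<open>
  \<open>Periodic a b\<close> is the rectangle with corners \<open>a\<close> and \<open>b\<close>, opposite sides identified;
  \<open>Homogeneous \<Omega>\<close> stands for \<open>\<Omega>\<close> with homogeneous boundary conditions.
\<close>

datatype bc_domain = Periodic "real^2" "real^2" | Homogeneous "(real^2) set"

fun dom_set :: "bc_domain \<Rightarrow> (real^2) set" where
  "dom_set (Periodic a b) = box a b"
| "dom_set (Homogeneous \<Omega>) = \<Omega>"

abbreviation dom_measure :: "bc_domain \<Rightarrow> (real^2) measure" where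
  "dom_measure D \<equiv> lebesgue_on (dom_set D)"

text \<open>Near each boundary point, the set is the strict epigraph of a Lipschitz function in some
  orthonormal coordinates \<open>(e, f)\<close>.\<close>

definition lipschitz_boundary :: "(real^2) set \<Rightarrow> bool" where
  "lipschitz_boundary \<Omega> \<longleftrightarrow>
     (\<forall>x\<in>frontier \<Omega>. \<exists>r>0. \<exists>e f. \<exists>\<gamma>::real \<Rightarrow> real. \<exists>C.
        norm e = 1 \<and> norm f = 1 \<and> e \<bullet> f = 0 \<and> C-lipschitz_on UNIV \<gamma> \<and>
        \<Omega> \<inter> ball x r = {y \<in> ball x r. \<gamma> (y \<bullet> e) < y \<bullet> f})"

fun valid_domain :: "bc_domain \<Rightarrow> bool" where
  "valid_domain (Periodic a b) \<longleftrightarrow> (\<forall>i. a $ i < b $ i)"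
| "valid_domain (Homogeneous \<Omega>) \<longleftrightarrow>
     open \<Omega> \<and> connected \<Omega> \<and> \<Omega> \<noteq> {} \<and> bounded \<Omega> \<and> lipschitz_boundary \<Omega>"

definition partial :: "2 \<Rightarrow> (real^2 \<Rightarrow> real) \<Rightarrow> real^2 \<Rightarrow> real" where
  "partial i f x = frechet_derivative f (at x) (axis i 1)"

definition gradient :: "(real^2 \<Rightarrow> real) \<Rightarrow> real^2 \<Rightarrow> real^2" where
  "gradient f x = (\<chi> i. partial i f x)"

primrec Ck :: "nat \<Rightarrow> (real^2 \<Rightarrow> real) \<Rightarrow> bool" where
  "Ck 0 f \<longleftrightarrow> continuous_on UNIV f"
| "Ck (Suc k) f \<longleftrightarrow> (\<forall>x. f differentiable at x) \<and> (\<forall>i. Ck k (partial i f))"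

definition smooth :: "(real^2 \<Rightarrow> real) \<Rightarrow> bool" where
  "smooth f \<longleftrightarrow> (\<forall>k. Ck k f)"

text \<open>Smooth functions on the torus, respectively smooth functions with compact support in \<open>\<Omega>\<close>.\<close>

fun test_functions :: "bc_domain \<Rightarrow> (real^2 \<Rightarrow> real) set" where
  "test_functions (Periodic a b) =
     {\<phi>. smooth \<phi> \<and> (\<forall>x i. \<phi> (x + axis i (b $ i - a $ i)) = \<phi> x)}"
| "test_functions (Homogeneous \<Omega>) =
     {\<phi>. smooth \<phi> \<and> compact (closure {x. \<phi> x \<noteq> 0}) \<and> closure {x. \<phi> x \<noteq> 0} \<subseteq> \<Omega>}"

definition ae_eq :: "bc_domain \<Rightarrow> (real^2 \<Rightarrow> 'b) \<Rightarrow> (real^2 \<Rightarrow> 'b) \<Rightarrow> bool" where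
  "ae_eq D f g \<longleftrightarrow> (AE x in dom_measure D. f x = g x)"

definition L2 :: "bc_domain \<Rightarrow> (real^2 \<Rightarrow> 'b::euclidean_space) set" where
  "L2 D = {f \<in> borel_measurable (dom_measure D). integrable (dom_measure D) (\<lambda>x. (norm (f x))\<^sup>2)}"

definition l2_inner ::
    "bc_domain \<Rightarrow> (real^2 \<Rightarrow> 'b::euclidean_space) \<Rightarrow> (real^2 \<Rightarrow> 'b) \<Rightarrow> real" where
  "l2_inner D f g = (LINT x|dom_measure D. f x \<bullet> g x)"

definition l2_norm :: "bc_domain \<Rightarrow> (real^2 \<Rightarrow> 'b::euclidean_space) \<Rightarrow> real" where
  "l2_norm D f = sqrt (l2_inner D f f)"

definition has_weak_partial ::
    "bc_domain \<Rightarrow> 2 \<Rightarrow> (real^2 \<Rightarrow> real) \<Rightarrow> (real^2 \<Rightarrow> real) \<Rightarrow> bool" where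
  "has_weak_partial D i f g \<longleftrightarrow>
     g \<in> L2 D \<and> (\<forall>\<phi>\<in>test_functions D. l2_inner D f (partial i \<phi>) = - l2_inner D g \<phi>)"

definition has_weak_div ::
    "bc_domain \<Rightarrow> (real^2 \<Rightarrow> real^2) \<Rightarrow> (real^2 \<Rightarrow> real) \<Rightarrow> bool" where
  "has_weak_div D v d \<longleftrightarrow>
     d \<in> L2 D \<and> (\<forall>\<phi>\<in>test_functions D. l2_inner D v (gradient \<phi>) = - l2_inner D d \<phi>)"

definition weak_partial :: "bc_domain \<Rightarrow> 2 \<Rightarrow> (real^2 \<Rightarrow> real) \<Rightarrow> real^2 \<Rightarrow> real" where
  "weak_partial D i f = (SOME g. has_weak_partial D i f g)"

definition weak_div :: "bc_domain \<Rightarrow> (real^2 \<Rightarrow> real^2) \<Rightarrow> real^2 \<Rightarrow> real" where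
  "weak_div D v = (SOME d. has_weak_div D v d)"

definition weak_curl :: "bc_domain \<Rightarrow> (real^2 \<Rightarrow> real) \<Rightarrow> real^2 \<Rightarrow> real^2" where
  "weak_curl D \<omega> x = vector [weak_partial D 2 \<omega> x, - weak_partial D 1 \<omega> x]"

definition H1 :: "bc_domain \<Rightarrow> (real^2 \<Rightarrow> real) set" where
  "H1 D = {f \<in> L2 D. \<forall>i. \<exists>g. has_weak_partial D i f g}"

definition Hdiv :: "bc_domain \<Rightarrow> (real^2 \<Rightarrow> real^2) set" where
  "Hdiv D = {v \<in> L2 D. \<exists>d. has_weak_div D v d}"

text \<open>Closures of the compactly supported smooth functions (fields) in the graph norms.\<close>

definition H1_0 :: "bc_domain \<Rightarrow> (real^2 \<Rightarrow> real) set" where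
  "H1_0 D = {f \<in> H1 D. \<exists>\<phi>. (\<forall>n::nat. \<phi> n \<in> test_functions D) \<and>
     (\<lambda>n. l2_norm D (\<lambda>x. \<phi> n x - f x)) \<longlonglongrightarrow> 0 \<and>
     (\<forall>i. (\<lambda>n. l2_norm D (\<lambda>x. partial i (\<phi> n) x - weak_partial D i f x)) \<longlonglongrightarrow> 0)}"

definition Hdiv_0 :: "bc_domain \<Rightarrow> (real^2 \<Rightarrow> real^2) set" where
  "Hdiv_0 D = {v \<in> Hdiv D. \<exists>\<phi>. (\<forall>n::nat. \<forall>i. (\<lambda>x. \<phi> n x $ i) \<in> test_functions D) \<and>
     (\<lambda>n. l2_norm D (\<lambda>x. \<phi> n x - v x)) \<longlonglongrightarrow> 0 \<and>
     (\<lambda>n. l2_norm D (\<lambda>x. (\<Sum>i\<in>UNIV. partial i (\<lambda>y. \<phi> n y $ i) x) - weak_div D v x)) \<longlonglongrightarrow> 0}"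

fun space0 :: "bc_domain \<Rightarrow> (real^2 \<Rightarrow> real) set" where
  "space0 (Periodic a b) = H1 (Periodic a b)"
| "space0 (Homogeneous \<Omega>) = H1_0 (Homogeneous \<Omega>)"

fun space1 :: "bc_domain \<Rightarrow> (real^2 \<Rightarrow> real^2) set" where
  "space1 (Periodic a b) = Hdiv (Periodic a b)"
| "space1 (Homogeneous \<Omega>) = Hdiv_0 (Homogeneous \<Omega>)"

definition space2 :: "bc_domain \<Rightarrow> (real^2 \<Rightarrow> real) set" where
  "space2 D = L2 D"

definition l2_subspace :: "bc_domain \<Rightarrow> (real^2 \<Rightarrow> 'b::euclidean_space) set \<Rightarrow> bool" where
  "l2_subspace D V \<longleftrightarrow> V \<subseteq> L2 D \<and> (\<lambda>x. 0) \<in> V \<and>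
     (\<forall>f\<in>V. \<forall>g\<in>V. (\<lambda>x. f x + g x) \<in> V) \<and>
     (\<forall>c. \<forall>f\<in>V. (\<lambda>x. c *\<^sub>R f x) \<in> V) \<and>
     (\<forall>f\<in>V. \<forall>g\<in>L2 D. ae_eq D f g \<longrightarrow> g \<in> V)"

definition finite_dim :: "bc_domain \<Rightarrow> (real^2 \<Rightarrow> 'b::euclidean_space) set \<Rightarrow> bool" where
  "finite_dim D V \<longleftrightarrow> (\<exists>(n::nat) b. (\<forall>i<n. b i \<in> V) \<and>
     (\<forall>f\<in>V. \<exists>c::nat \<Rightarrow> real. ae_eq D f (\<lambda>x. \<Sum>i<n. c i *\<^sub>R b i x)))"

definition ess_bounded :: "bc_domain \<Rightarrow> (real^2 \<Rightarrow> 'b::euclidean_space) \<Rightarrow> bool" where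
  "ess_bounded D f \<longleftrightarrow> (\<exists>C. AE x in dom_measure D. norm (f x) \<le> C)"

definition discrete_space :: "bc_domain \<Rightarrow> (real^2 \<Rightarrow> 'b::euclidean_space) set \<Rightarrow> bool" where
  "discrete_space D V \<longleftrightarrow> l2_subspace D V \<and> finite_dim D V \<and> (\<forall>f\<in>V. ess_bounded D f)"

definition discrete_complex ::
    "bc_domain \<Rightarrow> (real^2 \<Rightarrow> real) set \<Rightarrow> (real^2 \<Rightarrow> real^2) set \<Rightarrow> (real^2 \<Rightarrow> real) set \<Rightarrow> bool" where
  "discrete_complex D V0 V1 V2 \<longleftrightarrow>
     discrete_space D V0 \<and> discrete_space D V1 \<and> discrete_space D V2 \<and>
     V0 \<subseteq> space0 D \<and> V1 \<subseteq> space1 D \<and> V2 \<subseteq> space2 D \<and>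
     (\<forall>\<omega>\<in>V0. weak_curl D \<omega> \<in> V1) \<and> (\<forall>v\<in>V1. weak_div D v \<in> V2)"

text \<open>\<open>P\<close> is a linear projection, defined on equivalence classes in the broken space \<open>W\<close>, with
  range \<open>V\<close>.\<close>

definition projection_onto ::
    "bc_domain \<Rightarrow> (real^2 \<Rightarrow> real^2) set \<Rightarrow> (real^2 \<Rightarrow> real^2) set \<Rightarrow>
     ((real^2 \<Rightarrow> real^2) \<Rightarrow> (real^2 \<Rightarrow> real^2)) \<Rightarrow> bool" where
  "projection_onto D W V P \<longleftrightarrow> l2_subspace D W \<and> V \<subseteq> W \<and>
     (\<forall>v\<in>W. P v \<in> V) \<and> (\<forall>v\<in>V. ae_eq D (P v) v) \<and>
     (\<forall>v\<in>W. \<forall>w\<in>W. ae_eq D v w \<longrightarrow> ae_eq D (P v) (P w)) \<and>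
     (\<forall>v\<in>W. \<forall>w\<in>W. ae_eq D (P (\<lambda>x. v x + w x)) (\<lambda>x. P v x + P w x)) \<and>
     (\<forall>c. \<forall>v\<in>W. ae_eq D (P (\<lambda>x. c *\<^sub>R v x)) (\<lambda>x. c *\<^sub>R P v x))"

definition l2_proj ::
    "bc_domain \<Rightarrow> (real^2 \<Rightarrow> 'b::euclidean_space) set \<Rightarrow> (real^2 \<Rightarrow> 'b) \<Rightarrow> real^2 \<Rightarrow> 'b" where
  "l2_proj D V f = (SOME g. g \<in> V \<and> (\<forall>v\<in>V. l2_inner D g v = l2_inner D f v))"

definition dual_grad ::
    "bc_domain \<Rightarrow> (real^2 \<Rightarrow> real^2) set \<Rightarrow> (real^2 \<Rightarrow> real) \<Rightarrow> real^2 \<Rightarrow> real^2" where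
  "dual_grad D V1 q =
     (SOME g. g \<in> V1 \<and> (\<forall>v\<in>V1. l2_inner D g v = - l2_inner D q (weak_div D v)))"

definition dual_curl ::
    "bc_domain \<Rightarrow> (real^2 \<Rightarrow> real) set \<Rightarrow> (real^2 \<Rightarrow> real^2) \<Rightarrow> real^2 \<Rightarrow> real" where
  "dual_curl D V0 v =
     (SOME w. w \<in> V0 \<and> (\<forall>\<omega>\<in>V0. l2_inner D w \<omega> = l2_inner D v (weak_curl D \<omega>)))"

definition interior_prod ::
    "bc_domain \<Rightarrow> (real^2 \<Rightarrow> real) set \<Rightarrow> real^2 \<Rightarrow> (real^2 \<Rightarrow> real^2) \<Rightarrow> real^2 \<Rightarrow> real" where
  "interior_prod D V2 a u = l2_proj D V2 (\<lambda>x. a \<bullet> u x)"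

definition s_h ::
    "bc_domain \<Rightarrow> (real^2 \<Rightarrow> real^2) set \<Rightarrow> (real^2 \<Rightarrow> real) set \<Rightarrow>
     (real^2 \<Rightarrow> real^2) \<Rightarrow> (real^2 \<Rightarrow> real^2) \<Rightarrow> real^2 \<Rightarrow> real^2" where
  "s_h D V1 V2 u v =
     (let \<iota> = (\<lambda>k::2. interior_prod D V2 (axis k 1)) in
      (\<lambda>x. (1/2) *\<^sub>R l2_proj D V1
         (\<lambda>y. \<Sum>k\<in>UNIV. \<iota> k v y *\<^sub>R dual_grad D V1 (\<iota> k u) y
                        - \<iota> k u y *\<^sub>R dual_grad D V1 (\<iota> k v) y) x))"

definition midpoint_step :: "(nat \<Rightarrow> real^2 \<Rightarrow> real^2) \<Rightarrow> nat \<Rightarrow> real^2 \<Rightarrow> real^2" where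
  "midpoint_step u n = (\<lambda>x. (1/2) *\<^sub>R (u (Suc n) x + u n x))"

end

(*
  Test the momentum equation with a constant field e.  The viscous term drops out because the
  discrete curl of e vanishes (the weak curl of a function in V0 has mean zero), the pressure term
  because e is divergence free, and the stabilisation because e is conforming.  The discrete
  gradient of a constant is zero since weak divergences have mean zero, so the convective term
  reduces to half the L2 product of the midpoint velocity with the discrete gradient of one of its
  projected components.  That product vanishes because every iterate remains orthogonal to all
  discrete gradients: testing the momentum equation with a discrete gradient, the pressure equation
  removes the convective and pressure terms, and div curl = 0 removes the viscous one.

  Weak derivatives are chosen by SOME, so even the linearity of the weak divergence rests on their
  uniqueness almost everywhere, that is, on test functions separating L2.  Here this is reduced to
  indicators of boxes, obtained as limits of exp(-1/(n g)) on the set where g is positive, with g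
  polynomial for the homogeneous and trigonometric for the periodic boundary conditions.
*)
theory Submission imports Defs
begin

section \<open>Smooth functions\<close>

text \<open>\<open>flat 0\<close> is the classical smooth function whose derivatives all vanish at
  the origin. Differentiation brings in powers of \<open>1 / t\<close>, so the whole family in
  \<open>m\<close> is needed for closure under derivatives.\<close>

definition flat :: "nat \<Rightarrow> real \<Rightarrow> real" where
  "flat m t = (if t > 0 then (1 / t) ^ m * exp (- (1 / t)) else 0)"

lemma flat_tendsto_0: "(flat m \<longlongrightarrow> 0) (at_right 0)"
proof -
  have "((\<lambda>t. inverse t ^ m / exp (inverse t)) \<longlongrightarrow> 0) (at_right (0::real))"
    by (rule filterlim_compose[OF tendsto_power_div_exp_0 filterlim_inverse_at_top_right])
  then show ?thesis
    by (rule Lim_transform_eventually)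
       (auto simp: eventually_at_right_less flat_def exp_minus field_simps
             intro!: eventually_mono[OF eventually_at_right_less])
qed

text \<open>Away from the origin this is the product rule. At the origin both sides of the claimed
  formula vanish, and the difference quotient has to be computed by hand.\<close>

lemma flat_has_derivative:
  "(flat m has_real_derivative flat (m + 2) t - real m * flat (m + 1) t) (at t)"
proof (cases t "0::real" rule: linorder_cases)
  case greater
  have "((\<lambda>t. (1 / t) ^ m * exp (- (1 / t))) has_real_derivative
      flat (m + 2) t - real m * flat (m + 1) t) (at t)"
  proof (rule DERIV_cong)
    show "((\<lambda>t. (1 / t) ^ m * exp (- (1 / t))) has_real_derivative
        (1 / t) ^ m * (exp (- (1 / t)) * (1 / t)\<^sup>2)
        + real m * (1 / t) ^ (m - 1) * - (1 / t)\<^sup>2 * exp (- (1 / t))) (at t)"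
      using greater by (auto intro!: derivative_eq_intros simp: power2_eq_square)
    show "(1 / t) ^ m * (exp (- (1 / t)) * (1 / t)\<^sup>2)
        + real m * (1 / t) ^ (m - 1) * - (1 / t)\<^sup>2 * exp (- (1 / t))
      = flat (m + 2) t - real m * flat (m + 1) t"
      \<comment> \<open>The split deals with the truncated exponent \<open>m - 1\<close>: for
        \<open>m = 0\<close> it is harmless because its term carries the factor
        \<open>real m\<close>.\<close>
      using greater by (cases m) (simp_all add: flat_def power_add power2_eq_square)
  qed
  then show ?thesis
    by (rule has_field_derivative_transform_within_open[of _ _ _ "{0<..}"])
       (use greater in \<open>auto simp: flat_def\<close>)
next
  case less
  have "((\<lambda>t. 0) has_real_derivative flat (m + 2) t - real m * flat (m + 1) t) (at t)"
    using less by (auto simp: flat_def)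
  then show ?thesis
    by (rule has_field_derivative_transform_within_open[of _ _ _ "{..<0}"])
       (use less in \<open>auto simp: flat_def\<close>)
next
  case equal
  have "((\<lambda>h. flat m h / h) \<longlongrightarrow> 0) (at 0)"
  proof (rule filterlim_split_at)
    show "((\<lambda>h. flat m h / h) \<longlongrightarrow> 0) (at_left 0)"
      by (rule Lim_transform_eventually[OF tendsto_const])
         (auto simp: flat_def eventually_at_left_field intro!: exI[of _ "-1"])
    \<comment> \<open>To the right of the origin, dividing by \<open>h\<close> merely raises the
      index, giving \<open>flat (Suc m) h\<close>.\<close>
    show "((\<lambda>h. flat m h / h) \<longlongrightarrow> 0) (at_right 0)"
      by (rule Lim_transform_eventually[OF flat_tendsto_0[of "Suc m"]])
         (auto simp: flat_def intro!: eventually_mono[OF eventually_at_right_less])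
  qed
  then show ?thesis
    using equal by (simp add: has_field_derivative_iff flat_def)
qed

text \<open>Closed under partial derivatives, so that its members are smooth by induction on the order.\<close>

inductive smooth_expr :: "(real^2 \<Rightarrow> real) \<Rightarrow> bool" where
  const: "smooth_expr (\<lambda>x. c)"
| coord: "smooth_expr (\<lambda>x. x $ i)"
| add: "smooth_expr f \<Longrightarrow> smooth_expr g \<Longrightarrow> smooth_expr (\<lambda>x. f x + g x)"
| mult: "smooth_expr f \<Longrightarrow> smooth_expr g \<Longrightarrow> smooth_expr (\<lambda>x. f x * g x)"
| sin: "smooth_expr f \<Longrightarrow> smooth_expr (\<lambda>x. sin (f x))"
| cos: "smooth_expr f \<Longrightarrow> smooth_expr (\<lambda>x. cos (f x))"
| flat: "smooth_expr f \<Longrightarrow> smooth_expr (\<lambda>x. flat m (f x))"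

lemma smooth_expr_diff:
  assumes "smooth_expr f" "smooth_expr g"
  shows "smooth_expr (\<lambda>x. f x - g x)"
  using smooth_expr.add[OF assms(1) smooth_expr.mult[OF smooth_expr.const[of "-1"] assms(2)]] by simp

text \<open>The chain rule, shared by the sine, cosine and \<open>flat\<close> cases. The derivative
  of the outer function must again yield an expression, hence the premise on
  \<open>h'\<close>.\<close>

lemma smooth_expr_compose:
  assumes h: "\<And>t. (h has_real_derivative h' t) (at t)" and h': "smooth_expr (\<lambda>x. h' (f x))"
    and g: "\<And>i. smooth_expr (g i)"
      "\<And>x. (f has_derivative (\<lambda>v. \<Sum>i\<in>UNIV. g i x * v $ i)) (at x)"
  shows "\<exists>g. (\<forall>i. smooth_expr (g i)) \<and>
    (\<forall>x. ((\<lambda>x. h (f x)) has_derivative (\<lambda>v. \<Sum>i\<in>UNIV. g i x * v $ i)) (at x))"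
proof (intro exI[of _ "\<lambda>i x. g i x * h' (f x)"] conjI allI)
  show "smooth_expr (\<lambda>x. g i x * h' (f x))" for i
    by (rule smooth_expr.mult[OF g(1) h'])
  show "((\<lambda>x. h (f x)) has_derivative (\<lambda>v. \<Sum>i\<in>UNIV. g i x * h' (f x) * v $ i)) (at x)" for x
    using DERIV_compose_FDERIV[OF h g(2)]
    by (simp add: sum_distrib_left sum_distrib_right mult_ac)
qed

text \<open>That the gradient components are expressions again is what lets the argument be repeated
  for every order in \<open>smooth_expr_imp_smooth\<close>.\<close>

lemma smooth_expr_has_derivative:
  assumes "smooth_expr f"
  shows "\<exists>g. (\<forall>i. smooth_expr (g i)) \<and>
    (\<forall>x. (f has_derivative (\<lambda>v. \<Sum>i\<in>UNIV. g i x * v $ i)) (at x))"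
  using assms
proof induction
  case (const c)
  show ?case
    by (intro exI[of _ "\<lambda>i x. 0"]) (simp add: smooth_expr.const)
next
  case (coord i)
  show ?case
  proof (intro exI[of _ "\<lambda>j x. if j = i then 1 else 0"] conjI allI)
    show "smooth_expr (\<lambda>x. if j = i then 1 else 0)" for j
      by (rule smooth_expr.const)
    show "((\<lambda>x. x $ i) has_derivative (\<lambda>v. \<Sum>j\<in>UNIV. (if j = i then 1 else 0) * v $ j)) (at x)"
      for x :: "real^2"
    proof -
      have "(\<Sum>j\<in>UNIV. (if j = i then 1 else 0) * v $ j) = v $ i" for v :: "real^2"
        using exhaust_2[of i] by (auto simp: sum_2)
      then show ?thesis
        by (simp only: bounded_linear_imp_has_derivative[OF bounded_linear_vec_nth])
    qed
  qed
next
  case (add f g)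
  then obtain f' g' where *: "\<And>i. smooth_expr (f' i)" "\<And>i. smooth_expr (g' i)"
    "\<And>x. (f has_derivative (\<lambda>v. \<Sum>i\<in>UNIV. f' i x * v $ i)) (at x)"
    "\<And>x. (g has_derivative (\<lambda>v. \<Sum>i\<in>UNIV. g' i x * v $ i)) (at x)"
    by blast
  show ?case
  proof (intro exI[of _ "\<lambda>i x. f' i x + g' i x"] conjI allI)
    show "smooth_expr (\<lambda>x. f' i x + g' i x)" for i
      by (rule smooth_expr.add[OF *(1,2)])
    show "((\<lambda>x. f x + g x) has_derivative (\<lambda>v. \<Sum>i\<in>UNIV. (f' i x + g' i x) * v $ i)) (at x)"
      for x
      using has_derivative_add[OF *(3,4)] by (simp add: sum.distrib distrib_right)
  qed
next
  case (mult f g)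
  then obtain f' g' where *: "\<And>i. smooth_expr (f' i)" "\<And>i. smooth_expr (g' i)"
    "\<And>x. (f has_derivative (\<lambda>v. \<Sum>i\<in>UNIV. f' i x * v $ i)) (at x)"
    "\<And>x. (g has_derivative (\<lambda>v. \<Sum>i\<in>UNIV. g' i x * v $ i)) (at x)"
    by blast
  show ?case
  proof (intro exI[of _ "\<lambda>i x. f x * g' i x + f' i x * g x"] conjI allI)
    show "smooth_expr (\<lambda>x. f x * g' i x + f' i x * g x)" for i
      by (rule smooth_expr.add[OF smooth_expr.mult[OF mult.hyps(1) *(2)]
            smooth_expr.mult[OF *(1) mult.hyps(2)]])
    show "((\<lambda>x. f x * g x) has_derivative
        (\<lambda>v. \<Sum>i\<in>UNIV. (f x * g' i x + f' i x * g x) * v $ i)) (at x)" for x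
      using has_derivative_mult[OF *(3,4)]
      by (simp add: algebra_simps sum.distrib sum_distrib_left sum_distrib_right)
  qed
next
  case (sin f)
  then obtain g where "\<And>i. smooth_expr (g i)"
    "\<And>x. (f has_derivative (\<lambda>v. \<Sum>i\<in>UNIV. g i x * v $ i)) (at x)"
    by blast
  then show ?case
    by (rule smooth_expr_compose[OF DERIV_sin smooth_expr.cos[OF sin.hyps]])
next
  case (cos f)
  then obtain g where "\<And>i. smooth_expr (g i)"
    "\<And>x. (f has_derivative (\<lambda>v. \<Sum>i\<in>UNIV. g i x * v $ i)) (at x)"
    by blast
  moreover have "smooth_expr (\<lambda>x. - sin (f x))"
    using smooth_expr_diff[OF smooth_expr.const[of 0] smooth_expr.sin[OF cos.hyps]] by simp
  ultimately show ?case
    by (intro smooth_expr_compose[OF DERIV_cos])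
next
  case (flat f m)
  then obtain g where "\<And>i. smooth_expr (g i)"
    "\<And>x. (f has_derivative (\<lambda>v. \<Sum>i\<in>UNIV. g i x * v $ i)) (at x)"
    by blast
  moreover have "smooth_expr (\<lambda>x. flat (m + 2) (f x) - real m * flat (m + 1) (f x))"
    using flat.hyps by (intro smooth_expr_diff smooth_expr.mult smooth_expr.const smooth_expr.flat)
  ultimately show ?case
    by (intro smooth_expr_compose[OF flat_has_derivative])
qed

lemma partial_eq:
  assumes "(f has_derivative f') (at x)"
  shows "partial i f x = f' (axis i 1)"
  unfolding partial_def frechet_derivative_at[OF assms, symmetric] ..

lemma smooth_expr_imp_smooth:
  assumes "smooth_expr f"
  shows "smooth f"
proof -
  have "Ck k f" if "smooth_expr f" for k f
    using that
  proof (induction k arbitrary: f)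
    case 0
    then obtain g where "\<And>x. (f has_derivative (\<lambda>v. \<Sum>i\<in>UNIV. g i x * v $ i)) (at x)"
      using smooth_expr_has_derivative[OF 0] by blast
    then show ?case
      by (auto intro!: continuous_at_imp_continuous_on has_derivative_continuous)
  next
    case (Suc k)
    obtain g where g: "\<And>i. smooth_expr (g i)"
      "\<And>x. (f has_derivative (\<lambda>v. \<Sum>i\<in>UNIV. g i x * v $ i)) (at x)"
      using smooth_expr_has_derivative[OF Suc.prems] by blast
    have "partial i f = g i" for i
      by (rule ext, subst partial_eq[OF g(2)])
         (simp add: axis_def if_distrib[of "\<lambda>c. _ * c"] cong: if_cong)
    moreover have "f differentiable at x" for x
      using g(2) unfolding differentiable_def by blast
    ultimately show ?case
      using Suc.IH[OF g(1)] by simp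
  qed
  with assms show ?thesis
    by (simp add: smooth_def)
qed

lemma smooth_partial: "smooth f \<Longrightarrow> smooth (partial i f)"
  unfolding smooth_def by (metis Ck.simps(2))

lemma smooth_differentiable: "smooth f \<Longrightarrow> f differentiable at x"
  unfolding smooth_def by (metis Ck.simps(2))

lemma smooth_continuous_on: "smooth f \<Longrightarrow> continuous_on S f"
  unfolding smooth_def by (metis Ck.simps(1) continuous_on_subset subset_UNIV)

section \<open>Symmetry of second partial derivatives\<close>

lemma smooth_has_derivative_line:
  assumes "smooth f"
  shows "((\<lambda>t. f (x + t *\<^sub>R axis i 1)) has_real_derivative partial i f (x + t *\<^sub>R axis i 1))
    (at t within S)"
proof -
  let ?y = "x + t *\<^sub>R axis i 1"
  have f: "(f has_derivative frechet_derivative f (at ?y)) (at ?y)"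
    using smooth_differentiable[OF assms] by (simp add: frechet_derivative_works)
  have "((\<lambda>t. x + t *\<^sub>R axis i 1) has_derivative (\<lambda>h. h *\<^sub>R axis i 1)) (at t within S)"
    by (auto intro!: derivative_eq_intros)
  from has_derivative_compose[OF this f] show ?thesis
    unfolding has_field_derivative_def partial_def
    using linear_frechet_derivative[OF smooth_differentiable[OF assms]]
    by (simp add: linear_scale mult_commute_abs)
qed

text \<open>An increment of \<open>f\<close> along axis \<open>j\<close> is the integral of
  \<open>partial j f\<close>. Differentiating under the integral along axis \<open>i\<close>, and
  then with respect to the upper limit, produces the mixed derivative in the other order. This is
  what makes the divergence of a curl vanish.\<close>

lemma smooth_partial_commute:
  assumes "smooth f"
  shows "partial i (partial j f) x = partial j (partial i f) x"
proof -
  let ?p = "\<lambda>s t. x + s *\<^sub>R axis i 1 + t *\<^sub>R axis j (1::real)"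
  have p: "?p s t = x + t *\<^sub>R axis j 1 + s *\<^sub>R axis i 1" for s t
    by simp
  \<comment> \<open>Stated over any parameter space, because it serves both on an interval and,
    jointly in the two parameters, on a product.\<close>
  have cont: "continuous_on S (\<lambda>y. partial i (partial j f) (g y))" if "continuous_on S g"
    for S and g :: "'z::topological_space \<Rightarrow> _"
    by (rule continuous_on_compose2[OF smooth_continuous_on that])
       (use assms in \<open>auto intro!: smooth_partial\<close>)
  have cont1: "continuous_on S (\<lambda>y. partial j f (g y))" if "continuous_on S g"
    for S and g :: "'z::topological_space \<Rightarrow> _"
    by (rule continuous_on_compose2[OF smooth_continuous_on that])
       (use assms in \<open>auto intro!: smooth_partial\<close>)
  \<comment> \<open>The lower limit lies below 0 so that 0 is interior to \<open>{-1..1}\<close>,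
    and the derivative within that interval is an ordinary one.\<close>
  have ftc: "integral {-1..t} (\<lambda>\<tau>. partial j f (?p s \<tau>)) = f (?p s t) - f (?p s (-1))"
    if "t \<ge> -1" for s t
    using that smooth_has_derivative_line[OF assms]
    by (intro integral_unique fundamental_theorem_of_calculus)
       (auto simp: has_real_derivative_iff_has_vector_derivative[symmetric])
  have d1: "partial i f (?p 0 t) - partial i f (?p 0 (-1)) =
      integral {-1..t} (\<lambda>\<tau>. partial i (partial j f) (?p 0 \<tau>))" if "t \<ge> -1" for t
  proof -
    have "((\<lambda>s. integral (cbox (-1) t) (\<lambda>\<tau>. partial j f (?p s \<tau>))) has_real_derivative
        integral (cbox (-1) t) (\<lambda>\<tau>. partial i (partial j f) (?p 0 \<tau>))) (at 0)"
    proof (rule leibniz_rule_field_derivative)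
      show "((\<lambda>s. partial j f (?p s \<tau>)) has_real_derivative partial i (partial j f) (?p s \<tau>)) (at s)"
        for s \<tau>
        unfolding p by (rule smooth_has_derivative_line[OF smooth_partial[OF assms]])
    qed (auto simp: case_prod_unfold simp del: box_real
          intro!: cont cont1 integrable_continuous continuous_intros)
    moreover have "((\<lambda>s. f (?p s t) - f (?p s (-1))) has_real_derivative
        partial i f (?p 0 t) - partial i f (?p 0 (-1))) (at 0)"
      unfolding p by (intro DERIV_diff smooth_has_derivative_line assms)
    ultimately show ?thesis
      using ftc[OF that] by (auto dest: DERIV_unique)
  qed
  have "((\<lambda>t. integral {-1..t} (\<lambda>\<tau>. partial i (partial j f) (?p 0 \<tau>))) has_vector_derivative
      partial i (partial j f) (?p 0 0)) (at 0 within {-1..1})"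
    by (intro integral_has_vector_derivative cont continuous_intros) auto
  then have "((\<lambda>t. integral {-1..t} (\<lambda>\<tau>. partial i (partial j f) (?p 0 \<tau>))) has_real_derivative
      partial i (partial j f) x) (at 0 within {-1..1})"
    by (simp add: has_real_derivative_iff_has_vector_derivative)
  then have "((\<lambda>t. partial i f (?p 0 t) - partial i f (?p 0 (-1))) has_real_derivative
      partial i (partial j f) x) (at 0 within {-1..1})"
    by (rule has_field_derivative_transform_within[of _ _ _ _ 1]) (auto simp: d1[simplified])
  moreover have "((\<lambda>t. partial i f (?p 0 t) - partial i f (?p 0 (-1))) has_real_derivative
      partial j (partial i f) x) (at 0)"
    using smooth_has_derivative_line[OF smooth_partial[OF assms, of i], where i = j and t = 0 and S = UNIV]
    by (auto intro!: derivative_eq_intros)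
  moreover have "at (0::real) within {-1..1} = at 0"
    by (rule at_within_interior) auto
  ultimately show ?thesis
    by (auto dest: DERIV_unique)
qed

text \<open>Translating the box along the \<open>k\<close>-th axis leaves the integral of \<open>f\<close> unchanged; differentiate this at \<open>0\<close>.\<close>

lemma integral_partial_eq_0:
  assumes "smooth f" and lt: "a $ k < b $ k" and "\<delta> > 0"
    and periodic: "\<And>x. a $ k \<le> x $ k \<Longrightarrow> x $ k \<le> a $ k + \<delta> \<Longrightarrow>
      f (x + (b $ k - a $ k) *\<^sub>R axis k 1) = f x"
  shows "integral (cbox a b) (partial k f) = 0"
proof -
  let ?e = "axis k 1 :: real^2" and ?L = "b $ k - a $ k"
  have shift: "integral (cbox c d) (\<lambda>x. f (x + v)) = integral (cbox (c + v) (d + v)) f"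
    for c d v :: "real^2"
    using integral_shift_cbox[where f = f and a = "c + v" and b = "d + v" and c = v] by simp
  define G where "G t = integral (cbox a b) (\<lambda>x. f (x + t *\<^sub>R ?e))" for t
  have cont: "continuous_on S (\<lambda>y. f (g y))" "continuous_on S (\<lambda>y. partial k f (g y))"
    if "continuous_on S g" for S and g :: "'z::topological_space \<Rightarrow> _"
    by (rule continuous_on_compose2[OF smooth_continuous_on that];
        use assms(1) in \<open>auto intro!: smooth_partial\<close>)+
  have int: "f integrable_on cbox c d" for c d
    by (intro integrable_continuous smooth_continuous_on assms)
  have deriv: "(G has_real_derivative integral (cbox a b) (partial k f)) (at 0)"
  proof -
    have "(G has_real_derivative integral (cbox a b) (\<lambda>x. partial k f (x + 0 *\<^sub>R ?e))) (at 0)"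
      unfolding G_def
      by (rule leibniz_rule_field_derivative[where fx = "\<lambda>t x. partial k f (x + t *\<^sub>R ?e)"])
         (auto simp: case_prod_unfold intro!: cont integrable_continuous continuous_intros
            smooth_has_derivative_line assms)
    then show ?thesis by simp
  qed
  \<comment> \<open>The box stretched by \<open>t\<close> along axis \<open>k\<close> is cut in two
    ways: into a lower slab and the translated box, or into the original box and an upper slab.
    Periodicity equates the integrals over the two slabs.\<close>
  have const: "G t = G 0" if t: "0 < t" "t \<le> min \<delta> ?L" for t
  proof -
    \<comment> \<open>\<open>?c\<close> is the upper corner of the stretched box, \<open>?d\<close>
      that of the slab of thickness \<open>t\<close> at its lower face.\<close>
    let ?c = "b + t *\<^sub>R ?e" and ?d = "\<chi> i. if i = k then a $ k + t else b $ i"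
    have k: "k = 1 \<or> k = 2" by (rule exhaust_2)
    have ek: "?e \<in> Basis" by (simp add: axis_in_Basis_iff)
    have [simp]: "?e $ i = (if i = k then 1 else 0)" for i
      by (simp add: axis_def)
    have split: "integral (cbox a ?c) f =
        integral (cbox a ?c \<inter> {x. x $ k \<le> s}) f + integral (cbox a ?c \<inter> {x. x $ k \<ge> s}) f" for s
      using integral_split[OF int ek, of a ?c s] by (simp add: inner_axis)
    have "cbox a ?c \<inter> {x. x $ k \<le> a $ k + t} = cbox a ?d"
      using t lt k by (auto simp: mem_box_cart forall_2 axis_def)
    moreover have "cbox a ?c \<inter> {x. x $ k \<ge> a $ k + t} = cbox (a + t *\<^sub>R ?e) (b + t *\<^sub>R ?e)"
      using t lt k by (auto simp: mem_box_cart forall_2 axis_def)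
    moreover have "cbox a ?c \<inter> {x. x $ k \<le> b $ k} = cbox a b"
      using t lt k by (auto simp: mem_box_cart forall_2 axis_def)
    moreover have "cbox a ?c \<inter> {x. x $ k \<ge> b $ k} = cbox (a + ?L *\<^sub>R ?e) (?d + ?L *\<^sub>R ?e)"
      using t lt k by (auto simp: mem_box_cart forall_2 axis_def)
    moreover have "integral (cbox (a + ?L *\<^sub>R ?e) (?d + ?L *\<^sub>R ?e)) f = integral (cbox a ?d) f"
      unfolding shift[symmetric]
      by (intro integral_cong periodic) (use t k in \<open>auto simp: mem_box_cart forall_2\<close>)
    ultimately have "integral (cbox (a + t *\<^sub>R ?e) (b + t *\<^sub>R ?e)) f = integral (cbox a b) f"
      using split[of "a $ k + t"] split[of "b $ k"] by simp
    then show ?thesis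
      by (simp add: G_def shift)
  qed
  \<comment> \<open>\<open>G\<close> is known to be constant only to the right of 0, so its
    derivative is read off from the right-hand limit.\<close>
  have "((\<lambda>t. (G t - G 0) / (t - 0)) \<longlongrightarrow> integral (cbox a b) (partial k f)) (at_right 0)"
    using has_field_derivative_at_within[OF deriv] unfolding has_field_derivative_iff .
  moreover have "((\<lambda>t. (G t - G 0) / (t - 0)) \<longlongrightarrow> 0) (at_right 0)"
  proof (rule Lim_transform_eventually[OF tendsto_const])
    have "eventually (\<lambda>t. t \<in> {0<..<min \<delta> ?L}) (at_right 0)"
      using lt \<open>\<delta> > 0\<close> by (intro eventually_at_right_real) auto
    then show "eventually (\<lambda>t. 0 = (G t - G 0) / (t - 0)) (at_right 0)"
      by eventually_elim (simp add: const)
  qed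
  ultimately show ?thesis
    using tendsto_unique trivial_limit_at_right_real by blast
qed

section \<open>Test functions\<close>

lemma valid_domain_open: "valid_domain D \<Longrightarrow> open (dom_set D)"
  by (cases D) (auto simp: open_box)

lemma valid_domain_bounded: "valid_domain D \<Longrightarrow> bounded (dom_set D)"
  by (cases D) auto

lemma valid_domain_sets: "valid_domain D \<Longrightarrow> dom_set D \<in> sets lebesgue"
  using valid_domain_open by simp

lemma valid_domain_finite_measure:
  assumes "valid_domain D"
  shows "finite_measure (dom_measure D)"
  using assms valid_domain_open valid_domain_bounded
  by (intro finite_measure_lebesgue_on lmeasurable_open) auto

lemma test_function_smooth: "\<phi> \<in> test_functions D \<Longrightarrow> smooth \<phi>"
  by (cases D) auto

lemma partial_outside_support:
  assumes "x \<notin> closure {x. \<phi> x \<noteq> 0}"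
  shows "partial i \<phi> x = 0"
proof -
  have "(\<phi> has_derivative (\<lambda>v. 0)) (at x)"
  proof (rule has_derivative_transform_within_open)
    show "((\<lambda>x. 0) has_derivative (\<lambda>v. 0)) (at x)" by simp
    show "open (- closure {x. \<phi> x \<noteq> 0})" by (simp add: open_Compl)
    show "x \<in> - closure {x. \<phi> x \<noteq> 0}" using assms by simp
    show "0 = \<phi> y" if "y \<in> - closure {x. \<phi> x \<noteq> 0}" for y
      using that closure_subset[of "{x. \<phi> x \<noteq> 0}"] by auto
  qed
  then show ?thesis
    by (simp add: partial_eq)
qed

lemma partial_shift:
  assumes "\<phi> differentiable at (x + c)"
  shows "partial i (\<lambda>x. \<phi> (x + c)) x = partial i \<phi> (x + c)"
proof -
  have f: "(\<phi> has_derivative frechet_derivative \<phi> (at (x + c))) (at (x + c))"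
    using assms by (simp add: frechet_derivative_works)
  have shift: "((\<lambda>x. x + c) has_derivative (\<lambda>v. v)) (at x)"
    by (auto intro!: derivative_eq_intros)
  show ?thesis
    using partial_eq[OF has_derivative_compose[OF shift f], of i]
    unfolding partial_def[of i \<phi> "x + c"] .
qed

text \<open>Allows a weak derivative to be tested against a derivative of a test function, as the
  identity div curl = 0 requires.\<close>

lemma partial_test_function:
  assumes "\<phi> \<in> test_functions D"
  shows "partial i \<phi> \<in> test_functions D"
proof (cases D)
  case (Periodic a b)
  have "partial i \<phi> (x + axis j (b $ j - a $ j)) = partial i \<phi> x" for x j
  proof -
    have "(\<lambda>x. \<phi> (x + axis j (b $ j - a $ j))) = \<phi>"
      using assms Periodic by auto
    then show ?thesis
      using partial_shift[OF smooth_differentiable[OF test_function_smooth[OF assms]],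
          where i = i and x = x and c = "axis j (b $ j - a $ j)"] by simp
  qed
  then show ?thesis
    using assms Periodic smooth_partial by auto
next
  case (Homogeneous \<Omega>)
  have "closure {x. partial i \<phi> x \<noteq> 0} \<subseteq> closure {x. \<phi> x \<noteq> 0}"
    using partial_outside_support by (intro closure_minimal) auto
  moreover from this have "compact (closure {x. partial i \<phi> x \<noteq> 0})"
    using assms Homogeneous by (auto intro: bounded_subset simp: compact_eq_bounded_closed)
  ultimately show ?thesis
    using assms Homogeneous smooth_partial by auto
qed

section \<open>Continuous functions on the bounded domain\<close>

lemma continuous_dom_bounded:
  fixes f :: "real^2 \<Rightarrow> 'b::real_normed_vector"
  assumes "valid_domain D" "continuous_on UNIV f"
  obtains C where "\<And>x. x \<in> dom_set D \<Longrightarrow> norm (f x) \<le> C"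
proof -
  have "compact (f ` closure (dom_set D))"
    using assms valid_domain_bounded
    by (intro compact_continuous_image) (auto intro: continuous_on_subset)
  then obtain C where "\<forall>y\<in>f ` closure (dom_set D). norm y \<le> C"
    using compact_imp_bounded bounded_iff by blast
  then show ?thesis
    using that closure_subset by blast
qed

lemma continuous_measurable_dom:
  assumes "valid_domain D" "continuous_on UNIV f"
  shows "f \<in> borel_measurable (dom_measure D)"
  using assms valid_domain_sets
  by (intro continuous_imp_measurable_on_sets_lebesgue) (auto intro: continuous_on_subset)

lemma continuous_integrable_dom:
  fixes f :: "real^2 \<Rightarrow> 'b::euclidean_space"
  assumes "valid_domain D" "continuous_on UNIV f"
  shows "integrable (dom_measure D) f"
proof -
  interpret finite_measure "dom_measure D"
    by (rule valid_domain_finite_measure[OF assms(1)])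
  obtain C where "\<And>x. x \<in> dom_set D \<Longrightarrow> norm (f x) \<le> C"
    using continuous_dom_bounded[OF assms] by blast
  then show ?thesis
    by (intro integrable_const_bound[of _ C] continuous_measurable_dom assms AE_I2) auto
qed

lemma continuous_L2:
  fixes f :: "real^2 \<Rightarrow> 'b::euclidean_space"
  assumes "valid_domain D" "continuous_on UNIV f"
  shows "f \<in> L2 D"
  unfolding L2_def using assms
  by (auto intro!: continuous_measurable_dom continuous_integrable_dom continuous_intros)

text \<open>In the periodic case the domain is itself a period cell. In the homogeneous case the
  integral is moved to a large box around the support; near its opposite faces the function vanishes
  and so looks periodic.\<close>

lemma integral_partial_test_function:
  assumes "valid_domain D" "\<phi> \<in> test_functions D"
  shows "(LINT x|dom_measure D. partial k \<phi> x) = 0"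
proof -
  have smooth: "smooth \<phi>" "smooth (partial k \<phi>)"
    using assms test_function_smooth smooth_partial by auto
  have int: "integrable (dom_measure D) (partial k \<phi>)"
    using assms(1) smooth(2) by (intro continuous_integrable_dom smooth_continuous_on)
  then have eq: "(LINT x|dom_measure D. partial k \<phi> x) = integral (dom_set D) (partial k \<phi>)"
    using assms by (intro lebesgue_integral_eq_integral valid_domain_sets)
  show ?thesis
  proof (cases D)
    case (Periodic a b)
    have "integral (cbox a b) (partial k \<phi>) = 0"
    proof (rule integral_partial_eq_0[where \<delta> = 1])
      show "\<phi> (x + (b $ k - a $ k) *\<^sub>R axis k 1) = \<phi> x" for x
      proof -
        have "(b $ k - a $ k) *\<^sub>R axis k 1 = (axis k (b $ k - a $ k) :: real^2)"
          by (simp add: axis_def vec_eq_iff)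
        then show ?thesis
          using assms(2) Periodic by simp
      qed
    qed (use assms Periodic smooth in \<open>auto intro: less_imp_le\<close>)
    then show ?thesis
      using eq Periodic by (simp add: integral_open_interval)
  next
    case (Homogeneous \<Omega>)
    let ?S = "closure {x. \<phi> x \<noteq> 0}"
    have S: "?S \<subseteq> \<Omega>" "bounded ?S"
      using assms(2) Homogeneous by (auto intro: compact_imp_bounded)
    then obtain M where M: "M > 0" "\<And>x. x \<in> ?S \<Longrightarrow> norm x < M"
      unfolding bounded_pos_less by auto
    have out: "\<phi> x = 0" if "\<bar>x $ i\<bar> \<ge> M" for x i
      using M(2)[of x] closure_subset[of "{x. \<phi> x \<noteq> 0}"] component_le_norm_cart[of x i] that
      by force
    \<comment> \<open>The margin 1 beyond the bound \<open>M\<close> on the support makes the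
      function zero on a layer of thickness 1 at the lower face and on its translate.\<close>
    let ?a = "(\<chi> i. - (M + 1)) :: real^2" and ?b = "(\<chi> i. M + 1) :: real^2"
    have box: "?S \<subseteq> cbox ?a ?b"
    proof
      fix x assume "x \<in> ?S"
      then have "- (M + 1) \<le> x $ i \<and> x $ i \<le> M + 1" for i
        using M(2)[of x] component_le_norm_cart[of x i] by auto
      then show "x \<in> cbox ?a ?b"
        by (simp add: mem_box_cart)
    qed
    have "integral (cbox ?a ?b) (partial k \<phi>) = 0"
    proof (rule integral_partial_eq_0[where \<delta> = 1])
      show "\<phi> (x + (?b $ k - ?a $ k) *\<^sub>R axis k 1) = \<phi> x"
        if "?a $ k \<le> x $ k" "x $ k \<le> ?a $ k + 1" for x
      proof -
        have "M \<le> \<bar>x $ k\<bar>"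
          using that M by simp
        moreover have "M \<le> \<bar>(x + (?b $ k - ?a $ k) *\<^sub>R axis k 1) $ k\<bar>"
          using that M by (simp add: axis_def)
        ultimately show ?thesis
          using out by metis
      qed
    qed (use M smooth in auto)
    moreover have "integral A (partial k \<phi>) = integral UNIV (partial k \<phi>)" if "?S \<subseteq> A" for A
    proof -
      have "(\<lambda>x. if x \<in> A then partial k \<phi> x else 0) = partial k \<phi>"
        using that partial_outside_support[of _ \<phi> k] by (intro ext) auto
      then show ?thesis
        using Henstock_Kurzweil_Integration.integral_restrict_UNIV[of A "partial k \<phi>"] by simp
    qed
    note this[OF S(1)] this[OF box]
    ultimately show ?thesis
      using eq Homogeneous by simp
  qed
qed

text \<open>Open boxes form an intersection-stable generator of the Borel sets, so a Dynkin-system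
  induction extends the vanishing integrals to all Borel sets, and the density is then zero almost
  everywhere.\<close>

lemma AE_0_if_box_integrals_0:
  fixes f :: "'a::euclidean_space \<Rightarrow> real"
  assumes f: "integrable lebesgue f"
    and box: "\<And>l u. (LINT x:box l u|lebesgue. f x) = 0"
  shows "AE x in lebesgue. f x = 0"
proof -
  \<comment> \<open>The induction runs over Borel sets, so \<open>f\<close> is first replaced by a
    Borel representative \<open>g\<close>.\<close>
  obtain g where g[measurable]: "g \<in> borel_measurable lborel" and "AE x in lborel. f x = g x"
    using completion_ex_borel_measurable_real[OF borel_measurable_integrable[OF f]] by blast
  then have fg: "AE x in lebesgue. f x = g x"
    by (intro AE_completion)
  have int: "integrable lborel g"
    using integrable_cong_AE_imp[OF f measurable_completion[OF g]] fg integrable_completion[OF g]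
    by (simp add: eq_commute)
  have int_set: "set_integrable lborel A g" if "A \<in> sets borel" for A
    unfolding set_integrable_def using that int by (intro integrable_mult_indicator) auto
  have zero: "(LINT x:box l u|lborel. g x) = 0" for l u
  proof -
    have "(LINT x:box l u|lborel. g x) = (LINT x:box l u|lebesgue. g x)"
      unfolding set_lebesgue_integral_def by (intro integral_completion[symmetric]) auto
    also have "\<dots> = (LINT x:box l u|lebesgue. f x)"
      unfolding set_lebesgue_integral_def
    proof (rule integral_cong_AE)
      show "(\<lambda>x. indicat_real (box l u) x *\<^sub>R g x) \<in> borel_measurable lebesgue"
        by (intro borel_measurable_scaleR borel_measurable_indicator measurable_completion[OF g]) simp
      show "(\<lambda>x. indicat_real (box l u) x *\<^sub>R f x) \<in> borel_measurable lebesgue"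
        by (intro borel_measurable_scaleR borel_measurable_indicator borel_measurable_integrable f) simp
      show "AE x in lebesgue. indicat_real (box l u) x *\<^sub>R g x = indicat_real (box l u) x *\<^sub>R f x"
        using fg by eventually_elim simp
    qed
    finally show ?thesis
      using box by simp
  qed
  \<comment> \<open>The complement step of the induction needs the integral over the whole space,
    obtained here from an increasing sequence of boxes.\<close>
  have total: "(LINT x:UNIV|lborel. g x) = 0"
  proof -
    let ?A = "\<lambda>n::nat. box (- (real n *\<^sub>R One)) (real n *\<^sub>R One) :: 'a set"
    have "incseq ?A"
      unfolding incseq_def by (intro allI impI subset_box_imp) auto
    then have "(\<lambda>n. LINT x:?A n|lborel. g x) \<longlonglongrightarrow> (LINT x:(\<Union>n. ?A n)|lborel. g x)"
      by (intro set_integral_cont_up int_set) auto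
    then show ?thesis
      unfolding zero UN_box_eq_UNIV by (simp add: LIMSEQ_const_iff)
  qed
  have "(LINT x:A|lborel. g x) = 0" if "A \<in> sets borel" for A
  proof -
    let ?E = "range (\<lambda>(a, b). box a b :: 'a set)"
    have "Int_stable ?E"
      by (auto simp: Int_stable_def box_Int_box)
    moreover have "?E \<subseteq> Pow UNIV" by simp
    moreover have E: "sets borel = sigma_sets UNIV ?E"
      by (simp add: borel_eq_box)
    then have "A \<in> sigma_sets UNIV ?E" using that by simp
    ultimately show ?thesis
    proof (induction rule: sigma_sets_induct_disjoint)
      case (basic A)
      then show ?case using zero by auto
    next
      case empty
      then show ?case by (simp add: set_lebesgue_integral_def)
    next
      case (compl A)
      have "A \<in> sets borel" using compl(1) by (simp only: E)
      moreover from this have "UNIV - A \<in> sets borel" by (intro sets.Diff) auto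
      ultimately have "(LINT x:(UNIV - A) \<union> A|lborel. g x) = (LINT x:UNIV - A|lborel. g x) + (LINT x:A|lborel. g x)"
        by (intro set_integral_Un int_set) auto
      then show ?case using total compl by simp
    next
      case (union A)
      have "A i \<in> sets borel" for i using union(2) unfolding E by blast
      then have "(LINT x:(\<Union>i. A i)|lborel. g x) = (\<Sum>i. (LINT x:(A i)|lborel. g x))"
        using union(1) by (intro lebesgue_integral_countable_add int_set)
          (auto simp: disjoint_family_on_def)
      then show ?case using union by simp
    qed
  qed
  then have "AE x in lborel. g x = 0"
    using int by (intro density_unique_real) auto
  then have "AE x in lebesgue. g x = 0"
    by (rule AE_completion)
  with fg show ?thesis
    by eventually_elim simp
qed

section \<open>The L2 inner product\<close>

lemma L2_measurable: "f \<in> L2 D \<Longrightarrow> f \<in> borel_measurable (dom_measure D)"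
  by (simp add: L2_def)

lemma L2_inner_integrable:
  assumes "f \<in> L2 D" "g \<in> L2 D"
  shows "integrable (dom_measure D) (\<lambda>x. f x \<bullet> g x)"
proof (rule Bochner_Integration.integrable_bound)
  show "integrable (dom_measure D) (\<lambda>x. (norm (f x))\<^sup>2 + (norm (g x))\<^sup>2)"
    using assms by (simp add: L2_def)
  show "(\<lambda>x. f x \<bullet> g x) \<in> borel_measurable (dom_measure D)"
    using assms by (intro borel_measurable_inner L2_measurable)
  show "AE x in dom_measure D. norm (f x \<bullet> g x) \<le> norm ((norm (f x))\<^sup>2 + (norm (g x))\<^sup>2)"
  proof (rule AE_I2)
    fix x
    have "\<bar>f x \<bullet> g x\<bar> \<le> norm (f x) * norm (g x)"
      by (rule Cauchy_Schwarz_ineq2)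
    also have "\<dots> \<le> 2 * norm (f x) * norm (g x)"
      by simp
    also have "\<dots> \<le> (norm (f x))\<^sup>2 + (norm (g x))\<^sup>2"
      by (rule sum_squares_bound)
    finally show "norm (f x \<bullet> g x) \<le> norm ((norm (f x))\<^sup>2 + (norm (g x))\<^sup>2)"
      by simp
  qed
qed

lemma L2_integrable:
  fixes f :: "real^2 \<Rightarrow> 'b::euclidean_space"
  assumes "valid_domain D" "f \<in> L2 D"
  shows "integrable (dom_measure D) f"
proof (rule Bochner_Integration.integrable_bound)
  interpret finite_measure "dom_measure D"
    by (rule valid_domain_finite_measure[OF assms(1)])
  show "integrable (dom_measure D) (\<lambda>x. 1 + (norm (f x))\<^sup>2)"
    using assms by (simp add: L2_def)
  show "f \<in> borel_measurable (dom_measure D)"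
    using assms by (simp add: L2_def)
  have "norm y \<le> norm (1 + (norm y)\<^sup>2)" for y :: 'b
  proof -
    have "2 * norm y \<le> 1 + (norm y)\<^sup>2"
      using sum_squares_bound[of "norm y" 1] by simp
    moreover have "0 \<le> norm y" by simp
    ultimately show ?thesis
      unfolding real_norm_def by linarith
  qed
  then show "AE x in dom_measure D. norm (f x) \<le> norm (1 + (norm (f x))\<^sup>2)"
    by (intro AE_I2)
qed

lemma L2_add:
  assumes "f \<in> L2 D" "g \<in> L2 D"
  shows "(\<lambda>x. f x + g x) \<in> L2 D"
proof -
  have "(norm (f x + g x))\<^sup>2 = f x \<bullet> f x + 2 * (f x \<bullet> g x) + g x \<bullet> g x" for x
    by (simp add: power2_norm_eq_inner inner_add_left inner_add_right inner_commute)
  moreover have "integrable (dom_measure D) (\<lambda>x. f x \<bullet> f x + 2 * (f x \<bullet> g x) + g x \<bullet> g x)"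
    by (intro Bochner_Integration.integrable_add integrable_mult_right L2_inner_integrable assms)
  moreover have "(\<lambda>x. f x + g x) \<in> borel_measurable (dom_measure D)"
    by (intro borel_measurable_add L2_measurable assms)
  ultimately show ?thesis
    by (simp add: L2_def)
qed

lemma L2_scaleR:
  assumes "f \<in> L2 D"
  shows "(\<lambda>x. c *\<^sub>R f x) \<in> L2 D"
proof -
  have "(\<lambda>x. c *\<^sub>R f x) \<in> borel_measurable (dom_measure D)"
    by (intro borel_measurable_scaleR borel_measurable_const L2_measurable assms)
  then show ?thesis
    using assms by (simp add: L2_def power_mult_distrib)
qed

lemma L2_diff:
  assumes "f \<in> L2 D" "g \<in> L2 D"
  shows "(\<lambda>x. f x - g x) \<in> L2 D"
  using L2_add[OF assms(1) L2_scaleR[OF assms(2), of "-1"]] by simp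

lemma l2_inner_commute: "l2_inner D f g = l2_inner D g f"
  by (simp add: l2_inner_def inner_commute)

lemma l2_inner_add_left:
  assumes "f \<in> L2 D" "g \<in> L2 D" "h \<in> L2 D"
  shows "l2_inner D (\<lambda>x. f x + g x) h = l2_inner D f h + l2_inner D g h"
  using assms by (simp add: l2_inner_def inner_add_left L2_inner_integrable)

lemma l2_inner_diff_left:
  assumes "f \<in> L2 D" "g \<in> L2 D" "h \<in> L2 D"
  shows "l2_inner D (\<lambda>x. f x - g x) h = l2_inner D f h - l2_inner D g h"
  using assms by (simp add: l2_inner_def inner_diff_left L2_inner_integrable)

lemma l2_inner_scaleR_left: "l2_inner D (\<lambda>x. c *\<^sub>R f x) h = c * l2_inner D f h"
  by (simp add: l2_inner_def)

lemma l2_inner_diff_right: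
  assumes "f \<in> L2 D" "g \<in> L2 D" "h \<in> L2 D"
  shows "l2_inner D h (\<lambda>x. f x - g x) = l2_inner D h f - l2_inner D h g"
  unfolding l2_inner_commute[of D h] by (rule l2_inner_diff_left[OF assms])

lemma l2_inner_scaleR_right: "l2_inner D h (\<lambda>x. c *\<^sub>R f x) = c * l2_inner D h f"
  by (simp add: l2_inner_def)

lemma l2_inner_eq_0_if_ae_eq_0:
  assumes "ae_eq D f (\<lambda>x. 0)"
  shows "l2_inner D f g = 0" "l2_inner D g f = 0"
  using assms unfolding l2_inner_def ae_eq_def by (auto intro!: integral_eq_zero_AE)

lemma l2_inner_cong:
  assumes "ae_eq D f g" "f \<in> L2 D" "g \<in> L2 D" "h \<in> L2 D"
  shows "l2_inner D f h = l2_inner D g h" "l2_inner D h f = l2_inner D h g"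
proof -
  have "l2_inner D (\<lambda>x. f x - g x) h = 0"
    using assms(1) by (intro l2_inner_eq_0_if_ae_eq_0) (simp add: ae_eq_def)
  then show "l2_inner D f h = l2_inner D g h"
    using l2_inner_diff_left[OF assms(2-4)] by simp
  then show "l2_inner D h f = l2_inner D h g"
    by (simp only: l2_inner_commute[of D h])
qed

lemma l2_inner_self_eq_0:
  assumes "f \<in> L2 D" "l2_inner D f f = 0"
  shows "ae_eq D f (\<lambda>x. 0)"
  using assms L2_inner_integrable[OF assms(1,1)]
  by (simp add: l2_inner_def ae_eq_def integral_nonneg_eq_0_iff_AE)

text \<open>Cauchy-Schwarz from the nonnegative quadratic \<open>t\<close> \<mapsto>
  \<open>l2_inner D (f - t g) (f - t g)\<close>, written pointwise below. It is used to pass mean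
  values to L2 limits.\<close>

lemma l2_inner_bound:
  assumes f: "f \<in> L2 D" and g: "g \<in> L2 D"
  shows "\<bar>l2_inner D f g\<bar> \<le> l2_norm D f * l2_norm D g"
proof -
  have nn: "l2_inner D h h \<ge> 0" for h :: "_ \<Rightarrow> 'a"
    by (simp add: l2_inner_def)
  define A B C where "A = l2_inner D f f" and "B = l2_inner D f g" and "C = l2_inner D g g"
  have quad: "A - 2 * t * B + t\<^sup>2 * C \<ge> 0" for t
  proof -
    have "l2_inner D (\<lambda>x. f x - t *\<^sub>R g x) (\<lambda>x. f x - t *\<^sub>R g x) = A - 2 * t * B + t\<^sup>2 * C"
      using f g L2_scaleR[OF g, of t] L2_diff[OF f L2_scaleR[OF g, of t]]
      by (simp add: l2_inner_diff_left l2_inner_diff_right l2_inner_scaleR_left l2_inner_scaleR_right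
          l2_inner_commute[of D g f] A_def B_def C_def power2_eq_square algebra_simps)
    then show ?thesis using nn by metis
  qed
  have "B\<^sup>2 \<le> A * C"
  proof (cases "C = 0")
    case True
    then have "B = 0"
      using l2_inner_self_eq_0[OF g] l2_inner_eq_0_if_ae_eq_0 by (simp add: B_def C_def)
    with True show ?thesis by simp
  next
    case False
    then have "C > 0" using nn[of g] by (simp add: C_def)
    \<comment> \<open>\<open>B / C\<close> is the minimiser of the quadratic.\<close>
    with quad[of "B / C"] show ?thesis
      by (simp add: field_simps power2_eq_square)
  qed
  then have "sqrt (B\<^sup>2) \<le> sqrt (A * C)"
    by (rule real_sqrt_le_mono)
  then show ?thesis
    by (simp add: l2_norm_def A_def B_def C_def real_sqrt_mult)
qed

section \<open>Test functions separate square-integrable functions\<close>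

lemma flat_0_bounds: "0 \<le> flat 0 t" "flat 0 t \<le> 1"
  by (auto simp: flat_def)

text \<open>For positive \<open>y\<close> the exponent \<open>- 1 / (Suc n * y)\<close> tends to 0;
  otherwise the sequence is constantly 0. Smooth cutoffs thus converge to indicators.\<close>

lemma flat_0_tendsto_indicator:
  "(\<lambda>n. flat 0 (real (Suc n) * y)) \<longlonglongrightarrow> (if y > 0 then 1 else 0)"
proof (cases "y > 0")
  case True
  have "(\<lambda>n. exp (- (inverse (real (Suc n)) * (1 / y)))) \<longlonglongrightarrow> exp (- (0 * (1 / y)))"
    by (intro tendsto_intros LIMSEQ_inverse_real_of_nat)
  moreover have "exp (- (inverse (real (Suc n)) * (1 / y))) = flat 0 (real (Suc n) * y)" for n
    using True by (simp add: flat_def divide_inverse zero_less_mult_iff del: of_nat_Suc)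
  ultimately show ?thesis
    using True by simp
next
  case False
  then have "\<not> 0 < real (Suc n) * y" for n
    by (simp add: zero_less_mult_iff del: of_nat_Suc)
  then show ?thesis
    using False by (simp add: flat_def)
qed

text \<open>Dominated convergence, with one cutoff factor for each coordinate. \<open>S\<close> is
  matched with the positivity set only inside the domain, since a periodic cutoff is also positive
  on translates of the box.\<close>

lemma integral_bump_limit_eq_0:
  assumes D: "valid_domain D" and d: "d \<in> L2 D"
    and orth: "\<And>\<phi>. \<phi> \<in> test_functions D \<Longrightarrow> l2_inner D d \<phi> = 0"
    and bump: "\<And>n. (\<lambda>x. flat 0 (real (Suc n) * v x) * flat 0 (real (Suc n) * w x)) \<in> test_functions D"
    and S: "S \<in> sets lebesgue" "\<And>x. x \<in> dom_set D \<Longrightarrow> x \<in> S \<longleftrightarrow> v x > 0 \<and> w x > 0"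
  shows "(LINT x|dom_measure D. indicator S x * d x) = 0"
proof -
  let ?\<phi> = "\<lambda>n x. flat 0 (real (Suc n) * v x) * flat 0 (real (Suc n) * w x)"
  have d_meas: "d \<in> borel_measurable (dom_measure D)"
    by (rule L2_measurable[OF d])
  have "(\<lambda>n. LINT x|dom_measure D. d x * ?\<phi> n x) \<longlonglongrightarrow> (LINT x|dom_measure D. indicator S x * d x)"
  proof (rule integral_dominated_convergence)
    have "(\<lambda>x. indicator S x) \<in> borel_measurable lebesgue"
      using S(1) by simp
    then show "(\<lambda>x. indicator S x * d x) \<in> borel_measurable (dom_measure D)"
      by (intro borel_measurable_times d_meas measurable_restrict_space1)
    show "(\<lambda>x. d x * ?\<phi> n x) \<in> borel_measurable (dom_measure D)" for n
      using D bump[of n]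
      by (intro borel_measurable_times d_meas continuous_measurable_dom
          smooth_continuous_on test_function_smooth[of "?\<phi> n" D]) 
    show "integrable (dom_measure D) (\<lambda>x. norm (d x))"
      using L2_integrable[OF D d] by simp
    show "AE x in dom_measure D. norm (d x * ?\<phi> n x) \<le> norm (d x)" for n
      using flat_0_bounds
      by (intro AE_I2) (auto simp: abs_mult intro!: mult_left_le mult_le_one)
    show "AE x in dom_measure D. (\<lambda>n. d x * ?\<phi> n x) \<longlonglongrightarrow> indicator S x * d x"
    proof (rule AE_I2)
      fix x assume "x \<in> space (dom_measure D)"
      then have ind: "indicator S x = (if v x > 0 then 1 else 0) * (if w x > 0 then 1 else 0 :: real)"
        using S(2)[of x] by (auto simp: indicator_def)
      show "(\<lambda>n. d x * ?\<phi> n x) \<longlonglongrightarrow> indicator S x * d x"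
        unfolding ind mult.commute[of _ "d x"]
        by (intro tendsto_mult tendsto_const flat_0_tendsto_indicator)
    qed
  qed
  moreover have "(LINT x|dom_measure D. d x * ?\<phi> n x) = 0" for n
    using orth[OF bump[of n]] by (simp add: l2_inner_def)
  ultimately show ?thesis
    by (simp add: LIMSEQ_const_iff)
qed

text \<open>Extension of \<open>d\<close> by zero outside the domain and \<open>K\<close> reduces
  this to the whole plane. \<open>K\<close> confines the test to boxes on which cutoffs are
  available: the period cell, or a box whose closure lies in \<Omega>.\<close>

lemma AE_dom_0_if_box_integrals_0:
  assumes D: "valid_domain D" and d: "d \<in> L2 D" and K: "K \<in> sets lebesgue"
    and box: "\<And>l u. (LINT x|dom_measure D. indicator (box l u \<inter> K) x * d x) = (0::real)"
  shows "AE x in dom_measure D. x \<in> K \<longrightarrow> d x = 0"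
proof -
  let ?f = "\<lambda>x. indicator (dom_set D) x *\<^sub>R (indicator K x *\<^sub>R d x)"
  have \<Omega>: "dom_set D \<inter> space lebesgue \<in> sets lebesgue"
    using valid_domain_sets[OF D] by simp
  have "integrable lebesgue (\<lambda>x. indicator (dom_set D) x *\<^sub>R d x)"
    using L2_integrable[OF D d] integrable_restrict_space[OF \<Omega>, of d] by blast
  then have "integrable lebesgue (\<lambda>x. indicator K x *\<^sub>R (indicator (dom_set D) x *\<^sub>R d x))"
    by (rule integrable_mult_indicator[OF K])
  moreover have "(\<lambda>x. indicator K x *\<^sub>R (indicator (dom_set D) x *\<^sub>R d x)) = ?f"
    by (rule ext) (simp add: indicator_def)
  ultimately have f: "integrable lebesgue ?f"
    by (simp only:)
  have "(LINT x:box l u|lebesgue. ?f x) = 0" for l u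
  proof -
    have "(LINT x:box l u|lebesgue. ?f x) =
        (LINT x|lebesgue. indicator (dom_set D) x *\<^sub>R (indicator (box l u \<inter> K) x * d x))"
      unfolding set_lebesgue_integral_def
      by (intro Bochner_Integration.integral_cong) (auto simp: indicator_def)
    also have "\<dots> = (LINT x|dom_measure D. indicator (box l u \<inter> K) x * d x)"
      by (rule integral_restrict_space[OF \<Omega>, symmetric])
    finally show ?thesis
      using box by simp
  qed
  from AE_0_if_box_integrals_0[OF f this]
  have "AE x in lebesgue. x \<in> dom_set D \<longrightarrow> x \<in> K \<longrightarrow> d x = 0"
    by eventually_elim (auto simp: indicator_def)
  then show ?thesis
    by (simp add: AE_restrict_space_iff[OF \<Omega>])
qed

section \<open>Trigonometric cutoffs with the period of the cell\<close>

lemma sin_sign: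
  assumes "\<bar>t\<bar> < pi"
  shows "0 < sin t \<longleftrightarrow> 0 < t" "sin t < 0 \<longleftrightarrow> t < 0"
proof -
  have "sin t > 0" if "t > 0" using that assms by (intro sin_gt_zero) auto
  moreover have "sin t < 0" if "t < 0"
    using that assms sin_gt_zero[of "-t"] by simp
  moreover have "sin t = 0" if "t = 0" using that by simp
  ultimately show "0 < sin t \<longleftrightarrow> 0 < t" "sin t < 0 \<longleftrightarrow> t < 0"
    by (smt (verit))+
qed

text \<open>Each sine has the sign of its argument, as both arguments stay within half a sine period
  of 0. Two negative factors would force \<open>u < s < l\<close>, which contradicts
  \<open>l < u\<close>.\<close>

lemma sin_product_pos_iff:
  assumes "L > 0" "\<bar>s - l\<bar> < L" "\<bar>u - s\<bar> < L" "l < u"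
  shows "0 < sin (pi / L * (s - l)) * sin (pi / L * (u - s)) \<longleftrightarrow> l < s \<and> s < u"
proof -
  have small: "\<bar>pi / L * t\<bar> < pi" if "\<bar>t\<bar> < L" for t
    using that assms(1) by (simp add: abs_mult field_simps)
  have sign: "0 < sin (pi / L * t) \<longleftrightarrow> 0 < t" "sin (pi / L * t) < 0 \<longleftrightarrow> t < 0" if "\<bar>t\<bar> < L" for t
    using sin_sign[OF small[OF that]] assms(1) by (simp_all add: zero_less_divide_iff divide_less_0_iff zero_less_mult_iff mult_less_0_iff)
  show ?thesis
    unfolding zero_less_mult_iff sign[OF assms(2)] sign[OF assms(3)] using assms(4) by auto
qed

text \<open>Each factor changes sign under a shift by \<open>L\<close>, so the product is periodic
  although its factors have period \<open>2 * L\<close>.\<close>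

lemma sin_product_periodic:
  assumes "L > 0"
  shows "sin (pi / L * (s + L - l)) * sin (pi / L * (u - (s + L))) =
    sin (pi / L * (s - l)) * sin (pi / L * (u - s))"
proof -
  have "pi / L * (s + L - l) = pi / L * (s - l) + pi" "pi / L * (u - (s + L)) = pi / L * (u - s) - pi"
    using assms by (simp_all add: field_simps)
  then show ?thesis
    by simp
qed

text \<open>The fundamental lemma of the calculus of variations for both kinds of boundary
  condition. Cutoffs converging to indicators of boxes turn orthogonality into vanishing box
  integrals.\<close>

lemma test_functions_separate:
  assumes D: "valid_domain D" and d: "d \<in> L2 D"
    and orth: "\<And>\<phi>. \<phi> \<in> test_functions D \<Longrightarrow> l2_inner D d \<phi> = 0"
  shows "ae_eq D d (\<lambda>x. 0)"
proof (cases D)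
  case (Periodic a b)
  have "(LINT x|dom_measure D. indicator (box l u \<inter> box a b) x * d x) = 0" for l u
  proof (cases "box l u \<inter> box a b = {}")
    case True
    then show ?thesis by simp
  next
    case False
    then obtain y where "y \<in> box l u" "y \<in> box a b"
      by blast
    then have y: "l $ i < y $ i \<and> y $ i < u $ i \<and> a $ i < y $ i \<and> y $ i < b $ i" for i
      by (auto simp: mem_box_cart)
    \<comment> \<open>The corners of the intersection of the two boxes; the common point
      \<open>y\<close> makes it nondegenerate.\<close>
    define l' u' where "l' i = max (l $ i) (a $ i)" and "u' i = min (u $ i) (b $ i)" for i
    define w where "w i x = sin (pi / (b $ i - a $ i) * (x $ i - l' i)) *
      sin (pi / (b $ i - a $ i) * (u' i - x $ i))" for i and x :: "real^2"
    have L: "b $ i - a $ i > 0" for i using y[of i] by simp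
    have lu: "a $ i \<le> l' i" "l' i < u' i" "u' i \<le> b $ i" for i
      using y[of i] by (auto simp: l'_def u'_def)
    show ?thesis
    proof (rule integral_bump_limit_eq_0[OF D d orth, where v = "w 1" and w = "w 2"])
      fix n
      have "smooth_expr (w i)" for i
        unfolding w_def
        by (intro smooth_expr.mult smooth_expr.sin smooth_expr_diff smooth_expr.const smooth_expr.coord)
      then have "smooth (\<lambda>x. flat 0 (real (Suc n) * w 1 x) * flat 0 (real (Suc n) * w 2 x))"
        by (intro smooth_expr_imp_smooth smooth_expr.mult smooth_expr.flat smooth_expr.const)
      moreover have "w i (x + axis j (b $ j - a $ j)) = w i x" for i j x
        using sin_product_periodic[OF L[of i], of "x $ i" "l' i" "u' i"]
        by (cases "i = j") (auto simp: w_def axis_def)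
      ultimately show "(\<lambda>x. flat 0 (real (Suc n) * w 1 x) * flat 0 (real (Suc n) * w 2 x))
          \<in> test_functions D"
        using Periodic by simp
    next
      fix x assume x: "x \<in> dom_set D"
      have "0 < w i x \<longleftrightarrow> l' i < x $ i \<and> x $ i < u' i" for i
      proof -
        have "a $ i < x $ i" "x $ i < b $ i"
          using x Periodic by (auto simp: mem_box_cart)
        then show ?thesis
          unfolding w_def using lu[of i] by (intro sin_product_pos_iff L) auto
      qed
      then show "x \<in> box l u \<inter> box a b \<longleftrightarrow> w 1 x > 0 \<and> w 2 x > 0"
        by (auto simp: mem_box_cart forall_2 l'_def u'_def)
    qed auto
  qed
  from AE_dom_0_if_box_integrals_0[OF D d _ this] show ?thesis
    using Periodic by (auto simp: ae_eq_def AE_restrict_space_iff)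
next
  case (Homogeneous \<Omega>)
  \<comment> \<open>Only boxes whose closed hull lies in \<Omega> are treated first, since there the
    cutoffs have compact support in \<Omega>.\<close>
  have local: "AE x in dom_measure D. x \<in> box p q \<longrightarrow> d x = 0" if pq: "cbox p q \<subseteq> \<Omega>" for p q
  proof (rule AE_dom_0_if_box_integrals_0[OF D d])
    show "box p q \<in> sets lebesgue" by simp
    fix l u
    show "(LINT x|dom_measure D. indicator (box l u \<inter> box p q) x * d x) = 0"
    proof (cases "box l u \<inter> box p q = {}")
      case True
      then show ?thesis by simp
    next
      case False
      then obtain y where "y \<in> box l u" "y \<in> box p q"
      by blast
    then have y: "l $ i < y $ i \<and> y $ i < u $ i \<and> p $ i < y $ i \<and> y $ i < q $ i" for i
      by (auto simp: mem_box_cart)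
      define l' u' where "l' i = max (l $ i) (p $ i)" and "u' i = min (u $ i) (q $ i)" for i
      \<comment> \<open>Without a periodicity requirement a quadratic suffices: it is positive
        exactly between its two roots.\<close>
      define w where "w i x = (x $ i - l' i) * (u' i - x $ i)" for i and x :: "real^2"
      have lu: "l' i < u' i" for i
        using y[of i] by (auto simp: l'_def u'_def)
      have pos: "0 < w i x \<longleftrightarrow> l' i < x $ i \<and> x $ i < u' i" for i x
        using lu[of i] by (auto simp: w_def zero_less_mult_iff)
      then have S: "x \<in> box l u \<inter> box p q \<longleftrightarrow> w 1 x > 0 \<and> w 2 x > 0" for x
        by (auto simp: mem_box_cart forall_2 l'_def u'_def)
      show ?thesis
      proof (rule integral_bump_limit_eq_0[OF D d orth, where v = "w 1" and w = "w 2"])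
        fix n
        let ?\<phi> = "\<lambda>x. flat 0 (real (Suc n) * w 1 x) * flat 0 (real (Suc n) * w 2 x)"
        have "smooth_expr (w i)" for i
          unfolding w_def
          by (intro smooth_expr.mult smooth_expr_diff smooth_expr.const smooth_expr.coord)
        then have "smooth ?\<phi>"
          by (intro smooth_expr_imp_smooth smooth_expr.mult smooth_expr.flat smooth_expr.const)
        moreover have "{x. ?\<phi> x \<noteq> 0} \<subseteq> cbox p q"
        proof
          fix x assume "x \<in> {x. ?\<phi> x \<noteq> 0}"
          then have "w 1 x > 0 \<and> w 2 x > 0"
            by (auto simp: flat_def zero_less_mult_iff split: if_splits)
          then show "x \<in> cbox p q"
            using S[of x] box_subset_cbox by blast
        qed
        then have cl: "closure {x. ?\<phi> x \<noteq> 0} \<subseteq> cbox p q"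
          by (rule closure_minimal) (rule closed_cbox)
        have "compact (closure {x. ?\<phi> x \<noteq> 0})"
          unfolding compact_eq_bounded_closed
          by (rule conjI[OF bounded_subset[OF bounded_cbox cl] closed_closure])
        moreover have "closure {x. ?\<phi> x \<noteq> 0} \<subseteq> \<Omega>"
          using cl pq by (rule subset_trans)
        ultimately show "?\<phi> \<in> test_functions D"
          unfolding Homogeneous test_functions.simps mem_Collect_eq by (intro conjI)
      qed (use S in auto)
    qed
  qed
  \<comment> \<open>These boxes cover \<Omega>. By Lindelof countably many of them do so as well,
    and the exceptional null sets can be combined.\<close>
  let ?F = "{box p q | p q. cbox p q \<subseteq> \<Omega>}"
  have "open \<Omega>"
    using valid_domain_open[OF D] Homogeneous by simp
  have cover: "\<Omega> \<subseteq> \<Union> ?F"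
  proof
    fix x assume "x \<in> \<Omega>"
    then obtain p q where "cbox p q \<subseteq> \<Omega>" "x \<in> box p q"
      using open_contains_cbox[OF \<open>open \<Omega>\<close>] by metis
    then show "x \<in> \<Union> ?F"
      by blast
  qed
  have "open S" if "S \<in> ?F" for S
    using that open_box by blast
  then obtain F where F: "F \<subseteq> ?F" "countable F" "\<Union>F = \<Union>?F"
    by (rule Lindelof)
  have "AE x in dom_measure D. x \<in> K \<longrightarrow> d x = 0" if K: "K \<in> F" for K
  proof -
    obtain p q where "K = box p q" "cbox p q \<subseteq> \<Omega>"
      using F(1) K by blast
    then show ?thesis
      using local by simp
  qed
  then have "AE x in dom_measure D. \<forall>K\<in>F. x \<in> K \<longrightarrow> d x = 0"
    by (rule AE_ball_countable'[OF _ F(2)])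
  then have "AE x in dom_measure D. x \<in> \<Omega> \<longrightarrow> d x = 0"
  proof eventually_elim
    case (elim x)
    show ?case
    proof
      assume "x \<in> \<Omega>"
      then obtain K where "K \<in> F" "x \<in> K"
        using cover F(3) by (metis UnionE subsetD)
      then show "d x = 0" using elim by blast
    qed
  qed
  moreover have "AE x in dom_measure D. x \<in> \<Omega>"
    using Homogeneous by (intro AE_I2) simp
  ultimately show ?thesis
    unfolding ae_eq_def by eventually_elim simp
qed

section \<open>Riesz representation in finite-dimensional spaces\<close>

text \<open>Compatibility with almost-everywhere equality is required only at zero; linearity
  extends it to all of \<open>V\<close> in \<open>l2_functional_cong\<close>.\<close>

definition l2_functional :: "bc_domain \<Rightarrow> (real^2 \<Rightarrow> 'b::euclidean_space) set \<Rightarrow>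
    ((real^2 \<Rightarrow> 'b) \<Rightarrow> real) \<Rightarrow> bool" where
  "l2_functional D V F \<longleftrightarrow>
     (\<forall>f\<in>V. \<forall>g\<in>V. F (\<lambda>x. f x + g x) = F f + F g) \<and>
     (\<forall>c. \<forall>f\<in>V. F (\<lambda>x. c *\<^sub>R f x) = c * F f) \<and>
     (\<forall>f\<in>V. ae_eq D f (\<lambda>x. 0) \<longrightarrow> F f = 0)"

lemma l2_subspaceD:
  assumes "l2_subspace D V"
  shows "f \<in> V \<Longrightarrow> f \<in> L2 D" and "(\<lambda>x. 0) \<in> V"
    and "f \<in> V \<Longrightarrow> g \<in> V \<Longrightarrow> (\<lambda>x. f x + g x) \<in> V"
    and "f \<in> V \<Longrightarrow> (\<lambda>x. c *\<^sub>R f x) \<in> V"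
  using assms unfolding l2_subspace_def by blast+

lemma l2_subspace_diff:
  assumes "l2_subspace D V" "f \<in> V" "g \<in> V"
  shows "(\<lambda>x. f x - g x) \<in> V"
  using l2_subspaceD(3)[OF assms(1,2) l2_subspaceD(4)[OF assms(1,3), of "-1"]] by simp

lemma l2_functionalD:
  assumes "l2_functional D V F"
  shows "f \<in> V \<Longrightarrow> g \<in> V \<Longrightarrow> F (\<lambda>x. f x + g x) = F f + F g"
    and "f \<in> V \<Longrightarrow> F (\<lambda>x. c *\<^sub>R f x) = c * F f"
    and "f \<in> V \<Longrightarrow> ae_eq D f (\<lambda>x. 0) \<Longrightarrow> F f = 0"
  using assms unfolding l2_functional_def by simp_all

lemma l2_functional_diff:
  assumes V: "l2_subspace D V" and F: "l2_functional D V F" and f: "f \<in> V" and g: "g \<in> V"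
  shows "F (\<lambda>x. f x - g x) = F f - F g"
proof -
  have "F (\<lambda>x. f x + (-1) *\<^sub>R g x) = F f + F (\<lambda>x. (-1) *\<^sub>R g x)"
    by (rule l2_functionalD(1)[OF F f l2_subspaceD(4)[OF V g]])
  also have "F (\<lambda>x. (-1) *\<^sub>R g x) = (-1) * F g"
    by (rule l2_functionalD(2)[OF F g])
  finally show ?thesis by simp
qed

lemma l2_functional_cong:
  assumes V: "l2_subspace D V" and F: "l2_functional D V F" and f: "f \<in> V" and g: "g \<in> V"
    and "ae_eq D f g"
  shows "F f = F g"
proof -
  have "ae_eq D (\<lambda>x. f x - g x) (\<lambda>x. 0)"
    using assms(5) by (simp add: ae_eq_def)
  then have "F (\<lambda>x. f x - g x) = 0"
    by (rule l2_functionalD(3)[OF F l2_subspace_diff[OF V f g]])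
  then show ?thesis
    using l2_functional_diff[OF V F f g] by simp
qed

lemma l2_functional_inner:
  assumes V: "l2_subspace D V" and f: "f \<in> L2 D"
  shows "l2_functional D V (l2_inner D f)"
  unfolding l2_functional_def
proof (intro conjI ballI allI impI)
  fix g h assume "g \<in> V" "h \<in> V"
  then show "l2_inner D f (\<lambda>x. g x + h x) = l2_inner D f g + l2_inner D f h"
    unfolding l2_inner_commute[of D f] by (intro l2_inner_add_left f l2_subspaceD(1)[OF V])
qed (auto simp: l2_inner_scaleR_right l2_inner_eq_0_if_ae_eq_0)

lemma l2_functional_sum:
  fixes b :: "nat \<Rightarrow> real^2 \<Rightarrow> 'b::euclidean_space"
  assumes V: "l2_subspace D V" and b: "\<And>i. i < n \<Longrightarrow> b i \<in> V"
  shows "(\<lambda>x. \<Sum>i<n. c i *\<^sub>R b i x) \<in> V"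
    and "l2_functional D V F \<Longrightarrow> F (\<lambda>x. \<Sum>i<n. c i *\<^sub>R b i x) = (\<Sum>i<n. c i * F (b i))"
proof -
  have "(\<lambda>x. \<Sum>i<n. c i *\<^sub>R b i x) \<in> V \<and>
    (l2_functional D V F \<longrightarrow> F (\<lambda>x. \<Sum>i<n. c i *\<^sub>R b i x) = (\<Sum>i<n. c i * F (b i)))"
    using b
  proof (induction n)
    case 0
    then show ?case
      using l2_subspaceD(2)[OF V] by (simp add: l2_functional_def ae_eq_def)
  next
    case (Suc n)
    let ?s = "\<lambda>x. \<Sum>i<n. c i *\<^sub>R b i x" and ?t = "\<lambda>x. c n *\<^sub>R b n x"
    have s: "?s \<in> V" "l2_functional D V F \<Longrightarrow> F ?s = (\<Sum>i<n. c i * F (b i))"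
      using Suc by auto
    have bn: "b n \<in> V" using Suc by simp
    have t: "?t \<in> V" by (rule l2_subspaceD(4)[OF V bn])
    have "F (\<lambda>x. ?s x + ?t x) = F ?s + c n * F (b n)" if "l2_functional D V F"
      using that s(1) t bn unfolding l2_functional_def by simp
    then show ?case
      using s l2_subspaceD(3)[OF V s(1) t] by simp
  qed
  then show "(\<lambda>x. \<Sum>i<n. c i *\<^sub>R b i x) \<in> V"
    and "l2_functional D V F \<Longrightarrow> F (\<lambda>x. \<Sum>i<n. c i *\<^sub>R b i x) = (\<Sum>i<n. c i * F (b i))"
    by auto
qed

text \<open>A Gram-Schmidt step: the new generator is replaced by its component \<open>r\<close> orthogonal to the others,
  which contributes nothing if its norm vanishes.\<close>

lemma riesz_on_generators:
  fixes b :: "nat \<Rightarrow> real^2 \<Rightarrow> 'b::euclidean_space"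
  assumes V: "l2_subspace D V" and "\<And>i. i < n \<Longrightarrow> b i \<in> V" and "l2_functional D V F"
  shows "\<exists>c. \<forall>j<n. l2_inner D (\<lambda>x. \<Sum>i<n. c i *\<^sub>R b i x) (b j) = F (b j)"
  using assms(2,3)
proof (induction n arbitrary: F)
  case 0
  then show ?case by simp
next
  case (Suc n)
  note F = Suc.prems(2)
  have b: "b i \<in> V" if "i \<le> n" for i
    using Suc.prems(1) that by simp
  note L2 = l2_subspaceD(1)[OF V]
  define \<Sigma> where "\<Sigma> c = (\<lambda>x. \<Sum>i<n. c i *\<^sub>R b i x)" for c
  have \<Sigma>: "\<Sigma> c \<in> V" "l2_functional D V G \<Longrightarrow> G (\<Sigma> c) = (\<Sum>i<n. c i * G (b i))" for c G
    unfolding \<Sigma>_def by (auto intro!: l2_functional_sum V b)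
  obtain c where c: "\<And>j. j < n \<Longrightarrow> l2_inner D (\<Sigma> c) (b j) = F (b j)"
    unfolding \<Sigma>_def using Suc.IH[OF _ F] b by auto
  \<comment> \<open>\<open>\<Sigma> c'\<close> is the orthogonal projection of \<open>b n\<close>
    onto the span of the earlier generators.\<close>
  obtain c' where c': "\<And>j. j < n \<Longrightarrow> l2_inner D (\<Sigma> c') (b j) = l2_inner D (b n) (b j)"
    unfolding \<Sigma>_def using Suc.IH[OF _ l2_functional_inner[OF V L2[OF b[of n]]]] b by auto
  define r where "r = (\<lambda>x. b n x - \<Sigma> c' x)"
  have r: "r \<in> V"
    unfolding r_def by (rule l2_subspace_diff[OF V b[OF order_refl] \<Sigma>(1)])
  have inner: "l2_functional D V (l2_inner D f)" if "f \<in> V" for f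
    by (rule l2_functional_inner[OF V L2[OF that]])
  have r_orth: "l2_inner D r (b j) = 0" if "j < n" for j
    using l2_inner_diff_left[OF L2[OF b[OF order_refl]] L2[OF \<Sigma>(1)] L2[OF b[OF less_imp_le[OF that]]]]
      c'[OF that]
    by (simp add: r_def)
  \<comment> \<open>\<open>t\<close> is chosen so that \<open>g\<close> reproduces \<open>F\<close>
    on \<open>r\<close>. If \<open>r\<close> is null, \<open>F r\<close> is zero as well and the
    default 0 works.\<close>
  define t where "t = (if l2_inner D r r = 0 then 0 else (F r - l2_inner D (\<Sigma> c) r) / l2_inner D r r)"
  define g where "g = (\<lambda>x. \<Sigma> c x + t *\<^sub>R r x)"
  have g: "g \<in> V"
    unfolding g_def by (intro l2_subspaceD(3,4)[OF V] \<Sigma> r)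
  have g_inner: "l2_inner D g f = l2_inner D (\<Sigma> c) f + t * l2_inner D r f" if "f \<in> V" for f
    unfolding g_def
    by (simp add: l2_inner_add_left l2_inner_scaleR_left L2 \<Sigma> r that L2_scaleR)
  have low: "l2_inner D g (b j) = F (b j)" if "j < n" for j
    using g_inner[of "b j"] b[of j] c[OF that] r_orth[OF that] that by simp
  have bn: "b n = (\<lambda>x. r x + \<Sigma> c' x)"
    by (simp add: r_def)
  have "l2_inner D g r = F r"
  proof (cases "l2_inner D r r = 0")
    case True
    then have 0: "ae_eq D r (\<lambda>x. 0)"
      by (rule l2_inner_self_eq_0[OF L2[OF r]])
    then show ?thesis
      using F r l2_inner_eq_0_if_ae_eq_0(2)[OF 0, of g] by (simp add: l2_functional_def)
  next
    case False
    then show ?thesis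
      using g_inner[OF r] by (simp add: t_def)
  qed
  moreover have "l2_inner D g (\<Sigma> c') = F (\<Sigma> c')"
    using low by (simp add: \<Sigma>(2)[OF F] \<Sigma>(2)[OF inner[OF g]])
  moreover have "G (b n) = G r + G (\<Sigma> c')" if "l2_functional D V G" for G
    using that r \<Sigma>(1)[of c'] unfolding bn l2_functional_def by blast
  ultimately have "l2_inner D g (b n) = F (b n)"
    using F inner[OF g] by metis
  with low have all: "l2_inner D g (b j) = F (b j)" if "j < Suc n" for j
    using that less_Suc_eq by auto
  have "g = (\<lambda>x. \<Sum>i<Suc n. (if i = n then t else c i - t * c' i) *\<^sub>R b i x)"
    by (simp add: g_def r_def \<Sigma>_def scaleR_diff_left scaleR_diff_right sum_subtractf
        scaleR_sum_right algebra_simps)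
  with all show ?case
    by (intro exI[of _ "\<lambda>i. if i = n then t else c i - t * c' i"]) simp
qed

text \<open>Supplies the witnesses behind the choices in \<open>l2_proj\<close> and
  \<open>dual_grad\<close>. Agreement on generators is enough, because every element is almost
  everywhere equal to a combination of them.\<close>

lemma riesz_finite_dim:
  fixes V :: "(real^2 \<Rightarrow> 'b::euclidean_space) set"
  assumes V: "l2_subspace D V" and "finite_dim D V" and F: "l2_functional D V F"
  shows "\<exists>g. g \<in> V \<and> (\<forall>v\<in>V. l2_inner D g v = F v)"
proof -
  obtain n and b :: "nat \<Rightarrow> real^2 \<Rightarrow> 'b" where nb: "(\<forall>i<n. b i \<in> V) \<and>
      (\<forall>f\<in>V. \<exists>c::nat \<Rightarrow> real. ae_eq D f (\<lambda>x. \<Sum>i<n. c i *\<^sub>R b i x))"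
    using assms(2) unfolding finite_dim_def by (elim exE)
  have b: "\<And>i. i < n \<Longrightarrow> b i \<in> V"
    and gen: "\<And>f. f \<in> V \<Longrightarrow> \<exists>c::nat \<Rightarrow> real. ae_eq D f (\<lambda>x. \<Sum>i<n. c i *\<^sub>R b i x)"
    using nb by simp_all
  obtain c where c: "\<And>j. j < n \<Longrightarrow> l2_inner D (\<lambda>x. \<Sum>i<n. c i *\<^sub>R b i x) (b j) = F (b j)"
    using riesz_on_generators[where b = b and n = n, OF V b F] by blast
  let ?g = "\<lambda>x. \<Sum>i<n. c i *\<^sub>R b i x"
  have g: "?g \<in> V"
    by (rule l2_functional_sum(1)[OF V b])
  have inner: "l2_functional D V (l2_inner D ?g)"
    by (rule l2_functional_inner[OF V l2_subspaceD(1)[OF V g]])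
  have "l2_inner D ?g v = F v" if v: "v \<in> V" for v
  proof -
    obtain a where a: "ae_eq D v (\<lambda>x. \<Sum>i<n. a i *\<^sub>R b i x)"
      using gen[OF v] by blast
    let ?w = "\<lambda>x. \<Sum>i<n. a i *\<^sub>R b i x"
    have w: "?w \<in> V"
      by (rule l2_functional_sum(1)[OF V b])
    have "l2_inner D ?g v = (\<Sum>i<n. a i * l2_inner D ?g (b i))"
      unfolding l2_functional_cong[OF V inner v w a] by (rule l2_functional_sum(2)[OF V b inner])
    also have "\<dots> = (\<Sum>i<n. a i * F (b i))"
      using c by simp
    also have "\<dots> = F v"
      unfolding l2_functional_cong[OF V F v w a] by (rule l2_functional_sum(2)[OF V b F, symmetric])
    finally show ?thesis .
  qed
  with g show ?thesis by blast
qed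

section \<open>The L2 projection onto a discrete space\<close>

lemma L2_inner_const:
  assumes u: "u \<in> L2 D"
  shows "(\<lambda>x. a \<bullet> u x) \<in> L2 D"
proof -
  have meas: "(\<lambda>x. a \<bullet> u x) \<in> borel_measurable (dom_measure D)"
    by (intro borel_measurable_inner borel_measurable_const L2_measurable u)
  have "integrable (dom_measure D) (\<lambda>x. (norm (a \<bullet> u x))\<^sup>2)"
  proof (rule Bochner_Integration.integrable_bound)
    show "integrable (dom_measure D) (\<lambda>x. (norm a)\<^sup>2 * (norm (u x))\<^sup>2)"
      using u by (simp add: L2_def)
    show "(\<lambda>x. (norm (a \<bullet> u x))\<^sup>2) \<in> borel_measurable (dom_measure D)"
      using meas by simp
    have "(norm (a \<bullet> y))\<^sup>2 \<le> (norm a)\<^sup>2 * (norm y)\<^sup>2" for y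
      using Cauchy_Schwarz_ineq2[of a y] by (simp add: power_mult_distrib[symmetric] abs_le_square_iff[symmetric])
    then show "AE x in dom_measure D. norm ((norm (a \<bullet> u x))\<^sup>2) \<le> norm ((norm a)\<^sup>2 * (norm (u x))\<^sup>2)"
      by (intro AE_I2) (simp add: abs_mult)
  qed
  with meas show ?thesis
    by (simp add: L2_def)
qed

lemma discrete_spaceD:
  assumes "discrete_space D V"
  shows "l2_subspace D V" "finite_dim D V"
  using assms by (simp_all add: discrete_space_def)

lemma l2_proj:
  fixes V :: "(real^2 \<Rightarrow> 'b::euclidean_space) set"
  assumes V: "discrete_space D V" and f: "f \<in> L2 D"
  shows "l2_proj D V f \<in> V" "v \<in> V \<Longrightarrow> l2_inner D (l2_proj D V f) v = l2_inner D f v"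
proof -
  have "l2_proj D V f \<in> V \<and> (\<forall>v\<in>V. l2_inner D (l2_proj D V f) v = l2_inner D f v)"
    unfolding l2_proj_def
    using riesz_finite_dim[OF discrete_spaceD[OF V] l2_functional_inner[OF discrete_spaceD(1)[OF V] f]]
    by (rule someI_ex)
  then show "l2_proj D V f \<in> V" "v \<in> V \<Longrightarrow> l2_inner D (l2_proj D V f) v = l2_inner D f v"
    by auto
qed

text \<open>The residual lies in \<open>V\<close> and is orthogonal to \<open>V\<close>, hence to
  itself.\<close>

lemma l2_proj_ae_eq:
  fixes V :: "(real^2 \<Rightarrow> 'b::euclidean_space) set"
  assumes V: "discrete_space D V" and f: "f \<in> V"
  shows "ae_eq D (l2_proj D V f) f"
proof -
  note sub = discrete_spaceD(1)[OF V]
  note L2 = l2_subspaceD(1)[OF sub]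
  note P = l2_proj[OF V L2[OF f]]
  let ?r = "\<lambda>x. l2_proj D V f x - f x"
  have r: "?r \<in> V"
    by (rule l2_subspace_diff[OF sub P(1) f])
  have "l2_inner D ?r ?r = l2_inner D (l2_proj D V f) ?r - l2_inner D f ?r"
    by (rule l2_inner_diff_left[OF L2[OF P(1)] L2[OF f] L2[OF r]])
  also have "\<dots> = 0"
    using P(2)[OF r] by simp
  finally show ?thesis
    using l2_inner_self_eq_0[OF L2[OF r]] by (simp add: ae_eq_def)
qed

section \<open>Weak divergence and curl\<close>

lemma gradient_L2:
  assumes "valid_domain D" "\<phi> \<in> test_functions D"
  shows "gradient \<phi> \<in> L2 D"
proof -
  have "continuous_on UNIV (gradient \<phi>)"
    unfolding gradient_def
    using smooth_continuous_on[OF smooth_partial[OF test_function_smooth[OF assms(2)]]]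
    by (intro continuous_on_vec_lambda)
  then show ?thesis
    by (rule continuous_L2[OF assms(1)])
qed

lemma test_function_L2:
  assumes "valid_domain D" "\<phi> \<in> test_functions D"
  shows "\<phi> \<in> L2 D"
  using assms by (intro continuous_L2 smooth_continuous_on test_function_smooth)

text \<open>Makes the choice in \<open>weak_div\<close> harmless: any function that passes the test
  identity represents the same class.\<close>

lemma has_weak_div_unique:
  assumes D: "valid_domain D" and d: "has_weak_div D v d" and e: "has_weak_div D v e"
  shows "ae_eq D d e"
proof -
  have L2: "d \<in> L2 D" "e \<in> L2 D"
    using d e by (auto simp: has_weak_div_def)
  have "ae_eq D (\<lambda>x. d x - e x) (\<lambda>x. 0)"
  proof (rule test_functions_separate[OF D L2_diff[OF L2]])
    fix \<phi> assume \<phi>: "\<phi> \<in> test_functions D"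
    then have "l2_inner D d \<phi> = l2_inner D e \<phi>"
      using d e by (auto simp: has_weak_div_def)
    then show "l2_inner D (\<lambda>x. d x - e x) \<phi> = 0"
      using l2_inner_diff_left[OF L2 test_function_L2[OF D \<phi>]] by simp
  qed
  then show ?thesis by (simp add: ae_eq_def)
qed

lemma has_weak_div_add:
  assumes D: "valid_domain D" and L2: "v \<in> L2 D" "w \<in> L2 D"
    and d: "has_weak_div D v d" and e: "has_weak_div D w e"
  shows "has_weak_div D (\<lambda>x. v x + w x) (\<lambda>x. d x + e x)"
  unfolding has_weak_div_def
proof (intro conjI ballI)
  have de: "d \<in> L2 D" "e \<in> L2 D"
    using d e by (auto simp: has_weak_div_def)
  then show "(\<lambda>x. d x + e x) \<in> L2 D"
    by (rule L2_add)
  fix \<phi> assume \<phi>: "\<phi> \<in> test_functions D"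
  then show "l2_inner D (\<lambda>x. v x + w x) (gradient \<phi>) = - l2_inner D (\<lambda>x. d x + e x) \<phi>"
    using d e
    by (simp add: l2_inner_add_left[OF L2 gradient_L2[OF D \<phi>]]
        l2_inner_add_left[OF de test_function_L2[OF D \<phi>]] has_weak_div_def)
qed

lemma has_weak_div_scaleR:
  assumes "has_weak_div D v d"
  shows "has_weak_div D (\<lambda>x. c *\<^sub>R v x) (\<lambda>x. c *\<^sub>R d x)"
  using assms unfolding has_weak_div_def l2_inner_scaleR_left by (simp add: L2_scaleR del: real_scaleR_def)

lemma has_weak_div_0:
  assumes "valid_domain D" and "\<And>\<phi>. \<phi> \<in> test_functions D \<Longrightarrow> l2_inner D v (gradient \<phi>) = 0"
  shows "has_weak_div D v (\<lambda>x. 0)"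
  using assms by (simp add: has_weak_div_def continuous_L2 l2_inner_def)

lemma space0_H1: "\<omega> \<in> space0 D \<Longrightarrow> \<omega> \<in> H1 D"
  by (cases D) (auto simp: H1_0_def)

lemma space1_Hdiv: "v \<in> space1 D \<Longrightarrow> v \<in> Hdiv D"
  by (cases D) (auto simp: Hdiv_0_def)

lemma has_weak_div_weak_div: "v \<in> Hdiv D \<Longrightarrow> has_weak_div D v (weak_div D v)"
  using someI_ex[of "has_weak_div D v"] by (simp add: Hdiv_def weak_div_def)

lemma has_weak_partial_weak_partial: "\<omega> \<in> H1 D \<Longrightarrow> has_weak_partial D i \<omega> (weak_partial D i \<omega>)"
  using someI_ex[of "has_weak_partial D i \<omega>"] by (simp add: H1_def weak_partial_def)

section \<open>Mean values of weak derivatives\<close>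

lemma one_test_function: "(\<lambda>x. 1) \<in> test_functions (Periodic a b)"
  using smooth_expr_imp_smooth[OF smooth_expr.const] by simp

lemma partial_const: "partial i (\<lambda>x. c) x = 0"
  using partial_eq[of "\<lambda>x. c" "\<lambda>v. 0"] by simp

text \<open>The mean is the inner product with the constant 1, which is continuous in the L2 norm by
  Cauchy-Schwarz.\<close>

lemma integral_eq_0_if_L2_limit:
  assumes D: "valid_domain D" and f: "f \<in> L2 D" "\<And>n. g n \<in> L2 D"
    and int: "\<And>n. (LINT x|dom_measure D. g n x) = (0::real)"
    and lim: "(\<lambda>n. l2_norm D (\<lambda>x. g n x - f x)) \<longlonglongrightarrow> 0"
  shows "(LINT x|dom_measure D. f x) = 0"
proof -
  let ?one = "\<lambda>x. 1 :: real"
  have one: "?one \<in> L2 D"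
    by (rule continuous_L2[OF D]) (rule continuous_on_const)
  have bound: "\<bar>LINT x|dom_measure D. f x\<bar> \<le> l2_norm D (\<lambda>x. g n x - f x) * l2_norm D ?one" for n
  proof -
    have "l2_inner D (\<lambda>x. g n x - f x) ?one = - (LINT x|dom_measure D. f x)"
      using l2_inner_diff_left[OF f(2)[of n] f(1) one] int by (simp add: l2_inner_def)
    then show ?thesis
      using l2_inner_bound[OF L2_diff[OF f(2)[of n] f(1)] one] by simp
  qed
  have "(\<lambda>n. l2_norm D (\<lambda>x. g n x - f x) * l2_norm D ?one) \<longlonglongrightarrow> 0 * l2_norm D ?one"
    by (intro tendsto_intros lim)
  then have "\<bar>LINT x|dom_measure D. f x\<bar> \<le> 0 * l2_norm D ?one"
    by (rule LIMSEQ_le_const) (use bound in auto)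
  then show ?thesis by simp
qed

text \<open>On the torus the constant 1 is itself a test function. Under homogeneous conditions it
  is not, and the smooth approximants provided by \<open>Hdiv_0\<close> are used instead.\<close>

lemma integral_weak_div_eq_0:
  assumes D: "valid_domain D" and v: "v \<in> space1 D"
  shows "(LINT x|dom_measure D. weak_div D v x) = 0"
proof (cases D)
  case (Periodic a b)
  have "l2_inner D v (gradient (\<lambda>x. 1)) = - l2_inner D (weak_div D v) (\<lambda>x. 1)"
    using has_weak_div_weak_div[OF space1_Hdiv[OF v]] one_test_function
    unfolding has_weak_div_def Periodic by blast
  moreover have "gradient (\<lambda>x. 1) = (\<lambda>x. 0)"
    by (auto simp: gradient_def partial_const vec_eq_iff)
  ultimately show ?thesis
    by (simp add: l2_inner_def)
next
  case (Homogeneous \<Omega>)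
  then obtain \<phi> where \<phi>: "\<And>n i. (\<lambda>x. \<phi> n x $ i) \<in> test_functions D"
    and lim: "(\<lambda>n::nat. l2_norm D (\<lambda>x. (\<Sum>i\<in>UNIV. partial i (\<lambda>y. \<phi> n y $ i) x) - weak_div D v x)) \<longlonglongrightarrow> 0"
    using v by (auto simp: Hdiv_0_def)
  have cont: "continuous_on UNIV (partial i (\<lambda>y. \<phi> n y $ i))" for n i
    using \<phi> by (intro smooth_continuous_on smooth_partial test_function_smooth)
  show ?thesis
  proof (rule integral_eq_0_if_L2_limit[OF D _ _ _ lim])
    show "weak_div D v \<in> L2 D"
      using has_weak_div_weak_div[OF space1_Hdiv[OF v]] by (simp add: has_weak_div_def)
    show "(\<lambda>x. \<Sum>i\<in>UNIV. partial i (\<lambda>y. \<phi> n y $ i) x) \<in> L2 D" for n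
      by (intro continuous_L2 D continuous_on_sum cont)
    have "integrable (dom_measure D) (partial i (\<lambda>y. \<phi> n y $ i))" for n i
      by (intro continuous_integrable_dom D cont)
    then show "(LINT x|dom_measure D. (\<Sum>i\<in>UNIV. partial i (\<lambda>y. \<phi> n y $ i) x)) = 0" for n
      using integral_partial_test_function[OF D \<phi>] by simp
  qed
qed

lemma integral_weak_partial_eq_0:
  assumes D: "valid_domain D" and \<omega>: "\<omega> \<in> space0 D"
  shows "(LINT x|dom_measure D. weak_partial D i \<omega> x) = 0"
proof (cases D)
  case (Periodic a b)
  have "l2_inner D \<omega> (partial i (\<lambda>x. 1)) = - l2_inner D (weak_partial D i \<omega>) (\<lambda>x. 1)"
    using has_weak_partial_weak_partial[OF space0_H1[OF \<omega>]] one_test_function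
    unfolding has_weak_partial_def Periodic by blast
  then show ?thesis
    by (simp add: l2_inner_def partial_const)
next
  case (Homogeneous \<Omega>)
  then obtain \<phi> where \<phi>: "\<And>n. \<phi> n \<in> test_functions D"
    and lim: "(\<lambda>n::nat. l2_norm D (\<lambda>x. partial i (\<phi> n) x - weak_partial D i \<omega> x)) \<longlonglongrightarrow> 0"
    using \<omega> by (auto simp: H1_0_def)
  show ?thesis
  proof (rule integral_eq_0_if_L2_limit[OF D _ _ _ lim])
    show "weak_partial D i \<omega> \<in> L2 D"
      using has_weak_partial_weak_partial[OF space0_H1[OF \<omega>]] by (simp add: has_weak_partial_def)
    show "partial i (\<phi> n) \<in> L2 D" for n
      by (intro test_function_L2 D partial_test_function \<phi>)
    show "(LINT x|dom_measure D. partial i (\<phi> n) x) = 0" for n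
      by (rule integral_partial_test_function[OF D \<phi>])
  qed
qed

lemma inner_axis_weak_curl:
  "axis k 1 \<bullet> weak_curl D \<omega> x = (if k = 1 then weak_partial D 2 \<omega> x else - weak_partial D 1 \<omega> x)"
  using exhaust_2[of k] by (auto simp: weak_curl_def inner_axis' vector_2)

lemma l2_inner_const_weak_curl:
  assumes D: "valid_domain D" and \<omega>: "\<omega> \<in> space0 D"
  shows "l2_inner D (\<lambda>x. axis k 1) (weak_curl D \<omega>) = 0"
  using integral_weak_partial_eq_0[OF assms]
  by (cases "k = 1") (simp_all add: l2_inner_def inner_axis_weak_curl)

text \<open>Both derivatives are moved onto the test function, whose mixed partial derivatives
  commute.\<close>

lemma has_weak_div_weak_curl:
  assumes D: "valid_domain D" and \<omega>: "\<omega> \<in> space0 D"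
  shows "has_weak_div D (weak_curl D \<omega>) (\<lambda>x. 0)"
proof (rule has_weak_div_0[OF D])
  fix \<phi> assume \<phi>: "\<phi> \<in> test_functions D"
  let ?\<omega> = "\<lambda>i. weak_partial D i \<omega>"
  have wp: "has_weak_partial D i \<omega> (?\<omega> i)" for i
    by (rule has_weak_partial_weak_partial[OF space0_H1[OF \<omega>]])
  have ibp: "l2_inner D (?\<omega> i) (partial j \<phi>) = - l2_inner D \<omega> (partial i (partial j \<phi>))" for i j
    using wp[of i] partial_test_function[OF \<phi>, of j] unfolding has_weak_partial_def by simp
  have int: "integrable (dom_measure D) (\<lambda>x. ?\<omega> i x * partial j \<phi> x)" for i j
    using L2_inner_integrable[of "?\<omega> i" D "partial j \<phi>"] wp[of i]
      test_function_L2[OF D partial_test_function[OF \<phi>]]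
    by (simp add: has_weak_partial_def)
  have "l2_inner D (weak_curl D \<omega>) (gradient \<phi>) =
      (LINT x|dom_measure D. ?\<omega> 2 x * partial 1 \<phi> x - ?\<omega> 1 x * partial 2 \<phi> x)"
    unfolding l2_inner_def weak_curl_def gradient_def by (simp add: inner_vec_def sum_2 vector_2)
  also have "\<dots> = l2_inner D (?\<omega> 2) (partial 1 \<phi>) - l2_inner D (?\<omega> 1) (partial 2 \<phi>)"
    using int by (simp add: l2_inner_def)
  also have "\<dots> = 0"
    unfolding ibp using smooth_partial_commute[OF test_function_smooth[OF \<phi>]]
    by (simp add: l2_inner_def)
  finally show "l2_inner D (weak_curl D \<omega>) (gradient \<phi>) = 0" .
qed

lemma has_weak_div_const:
  assumes D: "valid_domain D"
  shows "has_weak_div D (\<lambda>x. axis k 1) (\<lambda>x. 0)"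
  using integral_partial_test_function[OF D]
  by (intro has_weak_div_0[OF D]) (simp add: l2_inner_def gradient_def inner_axis')

section \<open>The discrete complex\<close>

locale discrete_de_rham =
  fixes D :: bc_domain
    and V0 V2 :: "(real^2 \<Rightarrow> real) set"
    and V1 :: "(real^2 \<Rightarrow> real^2) set"
  assumes D: "valid_domain D"
    and discrete_complex: "discrete_complex D V0 V1 V2"
    and one_V2: "(\<lambda>x. 1) \<in> V2"
    and axis_V1: "(\<lambda>x. axis k 1) \<in> V1"
begin

lemma discrete: "discrete_space D V0" "discrete_space D V1" "discrete_space D V2"
  using discrete_complex by (auto simp: discrete_complex_def)

lemmas sub = discrete[THEN discrete_spaceD(1)]
lemmas L2 = sub[THEN l2_subspaceD(1)]

lemma in_spaces: "\<omega> \<in> V0 \<Longrightarrow> \<omega> \<in> space0 D" "v \<in> V1 \<Longrightarrow> v \<in> space1 D"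
  using discrete_complex by (auto simp: discrete_complex_def)

lemma weak_curl_V1: "\<omega> \<in> V0 \<Longrightarrow> weak_curl D \<omega> \<in> V1"
  using discrete_complex by (simp add: discrete_complex_def)

lemma weak_div_V2: "v \<in> V1 \<Longrightarrow> weak_div D v \<in> V2"
  using discrete_complex by (simp add: discrete_complex_def)

lemma has_weak_div_V1: "v \<in> V1 \<Longrightarrow> has_weak_div D v (weak_div D v)"
  by (intro has_weak_div_weak_div space1_Hdiv in_spaces)

lemma weak_div_ae_eq: "v \<in> V1 \<Longrightarrow> has_weak_div D v d \<Longrightarrow> ae_eq D (weak_div D v) d"
  by (rule has_weak_div_unique[OF D has_weak_div_V1])

text \<open>Chosen weak divergences are additive and homogeneous only almost everywhere, but the
  inner product with \<open>q\<close> does not see null sets.\<close>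

lemma l2_functional_weak_div:
  assumes q: "q \<in> V2"
  shows "l2_functional D V1 (\<lambda>v. - l2_inner D q (weak_div D v))"
proof -
  \<comment> \<open>Any weak divergence \<open>d\<close> of \<open>v\<close> may stand in for the
    chosen one; each property then needs just a suitable \<open>d\<close>.\<close>
  have div: "l2_inner D q (weak_div D v) = l2_inner D q d"
    if "v \<in> V1" "has_weak_div D v d" for v d
    using that(2)
    by (intro l2_inner_cong(2)[OF weak_div_ae_eq[OF that] L2(3)[OF weak_div_V2[OF that(1)]] _ L2(3)[OF q]])
       (simp add: has_weak_div_def)
  show ?thesis
    unfolding l2_functional_def
  proof (intro conjI ballI allI impI)
    fix v w assume v: "v \<in> V1" and w: "w \<in> V1"
    have "l2_inner D q (weak_div D (\<lambda>x. v x + w x)) = l2_inner D q (\<lambda>x. weak_div D v x + weak_div D w x)"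
      by (intro div l2_subspaceD(3)[OF sub(2)] has_weak_div_add D L2(2) has_weak_div_V1 v w)
    also have "\<dots> = l2_inner D q (weak_div D v) + l2_inner D q (weak_div D w)"
      unfolding l2_inner_commute[of D q] by (intro l2_inner_add_left L2(3) weak_div_V2 v w q)
    finally show "- l2_inner D q (weak_div D (\<lambda>x. v x + w x)) =
        - l2_inner D q (weak_div D v) + - l2_inner D q (weak_div D w)"
      by simp
  next
    fix c v assume v: "v \<in> V1"
    have "l2_inner D q (weak_div D (\<lambda>x. c *\<^sub>R v x)) = l2_inner D q (\<lambda>x. c *\<^sub>R weak_div D v x)"
      by (intro div l2_subspaceD(4)[OF sub(2)] has_weak_div_scaleR has_weak_div_V1 v)
    then show "- l2_inner D q (weak_div D (\<lambda>x. c *\<^sub>R v x)) = c * - l2_inner D q (weak_div D v)"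
      by (simp only: l2_inner_scaleR_right)
  next
    fix v assume v: "v \<in> V1" "ae_eq D v (\<lambda>x. 0)"
    have "has_weak_div D v (\<lambda>x. 0)"
      using v(2) by (intro has_weak_div_0 D l2_inner_eq_0_if_ae_eq_0)
    from div[OF v(1) this] show "- l2_inner D q (weak_div D v) = 0"
      by (simp add: l2_inner_def)
  qed
qed

section \<open>Discrete gradient and discrete curl\<close>

lemma dual_grad:
  assumes "q \<in> V2"
  shows "dual_grad D V1 q \<in> V1"
    and "v \<in> V1 \<Longrightarrow> l2_inner D (dual_grad D V1 q) v = - l2_inner D q (weak_div D v)"
proof -
  have "dual_grad D V1 q \<in> V1 \<and>
      (\<forall>v\<in>V1. l2_inner D (dual_grad D V1 q) v = - l2_inner D q (weak_div D v))"
    unfolding dual_grad_def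
    using riesz_finite_dim[OF discrete_spaceD[OF discrete(2)] l2_functional_weak_div[OF assms]]
    by (rule someI_ex)
  then show "dual_grad D V1 q \<in> V1"
    and "v \<in> V1 \<Longrightarrow> l2_inner D (dual_grad D V1 q) v = - l2_inner D q (weak_div D v)"
    by auto
qed

text \<open>Testing the discrete gradient with itself gives \<open>- c\<close> times the mean of a
  weak divergence, which is zero.\<close>

lemma dual_grad_const:
  assumes q: "q \<in> V2" and c: "ae_eq D q (\<lambda>x. c)"
  shows "ae_eq D (dual_grad D V1 q) (\<lambda>x. 0)"
proof (rule l2_inner_self_eq_0[OF L2(2)[OF dual_grad(1)[OF q]]])
  let ?G = "dual_grad D V1 q"
  have G: "?G \<in> V1" by (rule dual_grad(1)[OF q])
  have "l2_inner D ?G ?G = - l2_inner D q (weak_div D ?G)"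
    by (rule dual_grad(2)[OF q G])
  also have "l2_inner D q (weak_div D ?G) = l2_inner D (\<lambda>x. c *\<^sub>R 1) (weak_div D ?G)"
    using c by (intro l2_inner_cong(1) L2(3) l2_subspaceD(4)[OF sub(3)] one_V2 q weak_div_V2 G) simp
  also have "\<dots> = 0"
    unfolding l2_inner_scaleR_left using integral_weak_div_eq_0[OF D in_spaces(2)[OF G]]
    by (simp add: l2_inner_def)
  finally show "l2_inner D ?G ?G = 0" by simp
qed

text \<open>The zero function meets the specification, so the chosen function does too; testing the
  latter with itself shows that its norm is zero.\<close>

lemma dual_curl_eq_0:
  assumes "\<And>\<omega>. \<omega> \<in> V0 \<Longrightarrow> l2_inner D v (weak_curl D \<omega>) = 0"
  shows "ae_eq D (dual_curl D V0 v) (\<lambda>x. 0)"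
proof -
  let ?w = "dual_curl D V0 v"
  have "(\<lambda>x. 0) \<in> V0 \<and> (\<forall>\<omega>\<in>V0. l2_inner D (\<lambda>x. 0) \<omega> = l2_inner D v (weak_curl D \<omega>))"
    using assms l2_subspaceD(2)[OF sub(1)] by (simp add: l2_inner_def[of D "\<lambda>x. 0"])
  then have "?w \<in> V0 \<and> (\<forall>\<omega>\<in>V0. l2_inner D ?w \<omega> = l2_inner D v (weak_curl D \<omega>))"
    unfolding dual_curl_def
    by (rule someI[of "\<lambda>w. w \<in> V0 \<and> (\<forall>\<omega>\<in>V0. l2_inner D w \<omega> = l2_inner D v (weak_curl D \<omega>))"])
  then show ?thesis
    using assms by (intro l2_inner_self_eq_0 L2(1)) auto
qed

lemma dual_curl_axis: "ae_eq D (dual_curl D V0 (\<lambda>x. axis k 1)) (\<lambda>x. 0)"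
  by (intro dual_curl_eq_0 l2_inner_const_weak_curl D in_spaces)

text \<open>The discrete curl of a discrete gradient vanishes by duality from div curl = 0. This
  removes the viscous term when the momentum equation is tested with a discrete gradient.\<close>

lemma dual_curl_dual_grad:
  assumes q: "q \<in> V2"
  shows "ae_eq D (dual_curl D V0 (dual_grad D V1 q)) (\<lambda>x. 0)"
proof (rule dual_curl_eq_0)
  fix \<omega> assume \<omega>: "\<omega> \<in> V0"
  have "ae_eq D (weak_div D (weak_curl D \<omega>)) (\<lambda>x. 0)"
    by (intro weak_div_ae_eq weak_curl_V1 has_weak_div_weak_curl D in_spaces \<omega>)
  then show "l2_inner D (dual_grad D V1 q) (weak_curl D \<omega>) = 0"
    by (simp add: dual_grad(2)[OF q weak_curl_V1[OF \<omega>]] l2_inner_eq_0_if_ae_eq_0(2))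
qed

text \<open>Constant fields are divergence free; this removes the pressure term.\<close>

lemma dual_grad_axis:
  assumes q: "q \<in> V2"
  shows "l2_inner D (dual_grad D V1 q) (\<lambda>x. axis k 1) = 0"
  by (simp add: dual_grad(2)[OF q axis_V1] l2_inner_eq_0_if_ae_eq_0(2)[OF
        weak_div_ae_eq[OF axis_V1 has_weak_div_const[OF D]]])

lemma interior_prod_V2:
  assumes "u \<in> V1"
  shows "interior_prod D V2 a u \<in> V2"
proof -
  have "u \<in> L2 D" by (rule L2(2)[OF assms])
  then have "(\<lambda>x. a \<bullet> u x) \<in> L2 D"
    by (rule L2_inner_const)
  then show ?thesis
    unfolding interior_prod_def by (rule l2_proj(1)[OF discrete(3)])
qed

text \<open>The pointwise product of two axis vectors is a constant, which already lies in
  \<open>V2\<close> and is therefore left unchanged by the projection.\<close>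

lemma interior_prod_axis:
  "ae_eq D (interior_prod D V2 (axis j 1) (\<lambda>x. axis k 1)) (\<lambda>x. if j = k then 1 else 0)"
proof -
  have "(\<lambda>x. axis j 1 \<bullet> (axis k 1 :: real^2)) = (\<lambda>x::real^2. (if j = k then 1 else 0) *\<^sub>R (1::real))"
    by (auto simp: inner_axis_axis)
  moreover have "(\<lambda>x. (if j = k then 1 else 0) *\<^sub>R 1) \<in> V2"
    by (intro l2_subspaceD(4)[OF sub(3)] one_V2)
  ultimately show ?thesis
    unfolding interior_prod_def using l2_proj_ae_eq[OF discrete(3)] by fastforce
qed

text \<open>Since \<open>\<iota>\<^sub>j e\<^sub>k\<close> is the constant \<open>\<delta>\<^sub>j\<^sub>k\<close>, whose discrete gradient vanishes, only one of the four
  terms of \<open>s\<^sub>h(u, e\<^sub>k)\<close> survives.\<close>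

lemma s_h_axis:
  assumes u: "u \<in> V1" and w: "w \<in> V1"
  shows "l2_inner D w (s_h D V1 V2 u (\<lambda>x. axis k 1)) =
    1 / 2 * l2_inner D w (dual_grad D V1 (interior_prod D V2 (axis k 1) u))"
proof -
  let ?e = "\<lambda>x::real^2. axis k (1::real) :: real^2"
  let ?\<iota> = "\<lambda>j. interior_prod D V2 (axis j 1)"
  let ?G = "\<lambda>v j. dual_grad D V1 (?\<iota> j v)"
  define F where "F = (\<lambda>y. \<Sum>j\<in>UNIV. ?\<iota> j ?e y *\<^sub>R ?G u j y - ?\<iota> j u y *\<^sub>R ?G ?e j y)"
  have mem: "?\<iota> j v \<in> V2" "?G v j \<in> V1" if "v \<in> V1" for j v
    using that by (auto intro: interior_prod_V2 dual_grad(1))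
  have \<iota>_e: "AE y in dom_measure D. \<forall>j\<in>UNIV. ?\<iota> j ?e y = (if j = k then 1 else 0)"
    using interior_prod_axis unfolding ae_eq_def by (intro AE_finite_allI) auto
  have G_e: "AE y in dom_measure D. \<forall>j\<in>UNIV. ?G ?e j y = 0"
    using dual_grad_const[OF mem(1)[OF axis_V1] interior_prod_axis] unfolding ae_eq_def
    by (intro AE_finite_allI) auto
  have F_ae: "AE y in dom_measure D. F y = ?G u k y"
    using \<iota>_e G_e
  proof eventually_elim
    case (elim y)
    then show ?case
      using exhaust_2[of k] by (auto simp: F_def sum_2)
  qed
  have F_meas: "F \<in> borel_measurable (dom_measure D)"
    unfolding F_def
    by (intro borel_measurable_sum borel_measurable_diff borel_measurable_scaleR L2_measurable
        L2(2,3) mem u axis_V1)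
  have G: "?G u k \<in> V1"
    by (rule mem(2)[OF u])
  \<comment> \<open>Square integrability is inherited from \<open>?G u k\<close>, to which
    \<open>F\<close> is equal almost everywhere. \<open>V1\<close> is closed under that equality
    within L2, so it contains \<open>F\<close>.\<close>
  have "integrable (dom_measure D) (\<lambda>y. (norm (F y))\<^sup>2)"
  proof (rule integrable_cong_AE_imp)
    show "integrable (dom_measure D) (\<lambda>y. (norm (?G u k y))\<^sup>2)"
      using L2(2)[OF G] by (simp add: L2_def)
    show "(\<lambda>y. (norm (F y))\<^sup>2) \<in> borel_measurable (dom_measure D)"
      using F_meas by simp
    show "AE y in dom_measure D. (norm (?G u k y))\<^sup>2 = (norm (F y))\<^sup>2"
      using F_ae by eventually_elim simp
  qed
  then have "F \<in> L2 D"
    using F_meas by (simp add: L2_def)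
  moreover have "ae_eq D (?G u k) F"
    unfolding ae_eq_def using F_ae by eventually_elim simp
  ultimately have F: "F \<in> V1"
    using sub(2) G unfolding l2_subspace_def by blast
  have "l2_inner D w (s_h D V1 V2 u ?e) = 1 / 2 * l2_inner D w (l2_proj D V1 F)"
    unfolding s_h_def Let_def F_def by (rule l2_inner_scaleR_right)
  \<comment> \<open>The projection drops out because \<open>w\<close> belongs to
    \<open>V1\<close>.\<close>
  also have "l2_inner D w (l2_proj D V1 F) = l2_inner D w F"
    using l2_proj(2)[OF discrete(2) L2(2)[OF F] w] by (simp only: l2_inner_commute[of D w])
  also have "\<dots> = l2_inner D w (?G u k)"
    using F_ae by (intro l2_inner_cong(2) L2(2) F mem u w) (simp add: ae_eq_def)
  finally show ?thesis .
qed

end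

section \<open>Momentum balance of the Crank-Nicolson scheme\<close>

theorem proposition11:
  fixes D :: bc_domain
    and V0 V2 :: "(real^2 \<Rightarrow> real) set"
    and V1 W :: "(real^2 \<Rightarrow> real^2) set"
    and P1c :: "(real^2 \<Rightarrow> real^2) \<Rightarrow> (real^2 \<Rightarrow> real^2)"
    and \<Delta>t \<nu> \<alpha> :: real
    and u :: "nat \<Rightarrow> real^2 \<Rightarrow> real^2"
    and p :: "nat \<Rightarrow> real^2 \<Rightarrow> real"
  assumes "valid_domain D"
    and "discrete_complex D V0 V1 V2"
    and "projection_onto D W V1 P1c"
    and "(\<lambda>x. 1) \<in> V2"
    and "\<forall>k. (\<lambda>x. axis k 1) \<in> V1"
    and "\<Delta>t > 0" and "\<nu> \<ge> 0" and "\<alpha> \<ge> 0"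
    and "\<forall>n. u n \<in> V1"
    and "\<forall>n\<ge>1. p n \<in> V2"
    and "ae_eq D (weak_div D (u 0)) (\<lambda>x. 0)"
    and "\<forall>n. \<forall>v\<in>V1.
           l2_inner D (\<lambda>x. (1/\<Delta>t) *\<^sub>R (u (n+1) x - u n x)) v
         + l2_inner D (midpoint_step u n) (s_h D V1 V2 (midpoint_step u n) v)
         + l2_inner D (dual_grad D V1 (p (n+1))) v
         + \<nu> * l2_inner D (dual_curl D V0 (midpoint_step u n)) (dual_curl D V0 v)
         + \<alpha> * l2_inner D (\<lambda>x. midpoint_step u n x - P1c (midpoint_step u n) x)
                          (\<lambda>x. v x - P1c v x) = 0"
    and "\<forall>n. \<forall>q\<in>V2.
           l2_inner D (midpoint_step u n) (s_h D V1 V2 (midpoint_step u n) (dual_grad D V1 q))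
         + l2_inner D (dual_grad D V1 (p (n+1))) (dual_grad D V1 q) = 0"
  shows "\<forall>n. (1/\<Delta>t) *\<^sub>R
           ((LINT x|dom_measure D. u (n+1) x) - (LINT x|dom_measure D. u n x)) = 0"
proof -
  interpret discrete_de_rham D V0 V2 V1
    using assms(1,2,4,5) by unfold_locales auto
  have u: "u n \<in> V1" for n
    using assms(9) by blast
  have p: "p (n + 1) \<in> V2" for n
    using assms(10) by simp
  have mid: "midpoint_step u n \<in> V1" for n
    unfolding midpoint_step_def by (intro l2_subspaceD(3,4)[OF sub(2)] u)
  \<comment> \<open>A conforming \<open>v\<close> is fixed by the projection almost everywhere, so
    its stabilisation residual is null.\<close>
  have stab: "l2_inner D f (\<lambda>x. v x - P1c v x) = 0" if "v \<in> V1" for f v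
    using assms(3) that
    by (intro l2_inner_eq_0_if_ae_eq_0) (auto simp: projection_onto_def ae_eq_def)
  have step: "l2_inner D (\<lambda>x. (1/\<Delta>t) *\<^sub>R (u (n+1) x - u n x)) v =
      1 / \<Delta>t * (l2_inner D (u (n+1)) v - l2_inner D (u n) v)" if "v \<in> V1" for n v
    unfolding l2_inner_scaleR_left l2_inner_diff_left[OF L2(2)[OF u] L2(2)[OF u] L2(2)[OF that]] ..
  \<comment> \<open>A weak form of incompressibility, carried along by induction from the
    divergence-free initial field.\<close>
  have solenoidal: "l2_inner D (u n) (dual_grad D V1 q) = 0" if q: "q \<in> V2" for n q
  proof (induction n)
    case 0
    have "l2_inner D q (weak_div D (u 0)) = 0"
      using assms(11) by (rule l2_inner_eq_0_if_ae_eq_0)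
    then show ?case
      using dual_grad(2)[OF q u] by (simp add: l2_inner_commute[of D "u 0"])
  next
    case (Suc n)
    let ?G = "dual_grad D V1 q"
    have G: "?G \<in> V1" by (rule dual_grad(1)[OF q])
    \<comment> \<open>The pressure equation for \<open>q\<close> says exactly that the convective
      and pressure terms of the momentum equation tested with \<open>?G\<close> cancel; the other
      two terms vanish separately.\<close>
    have "1 / \<Delta>t * (l2_inner D (u (n+1)) ?G - l2_inner D (u n) ?G) = 0"
      using assms(12)[rule_format, OF G, of n] assms(13)[rule_format, OF q, of n]
      unfolding step[OF G] stab[OF G] l2_inner_eq_0_if_ae_eq_0(2)[OF dual_curl_dual_grad[OF q]]
      by linarith
    then show ?case
      using Suc assms(6) by simp
  qed
  show ?thesis
  proof
    fix n
    have "(LINT x|dom_measure D. u (n+1) x) \<bullet> axis k 1 - (LINT x|dom_measure D. u n x) \<bullet> axis k 1 = 0"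
      for k
    proof -
      let ?e = "\<lambda>x::real^2. axis k (1::real) :: real^2"
      \<comment> \<open>The projected \<open>k\<close>-th component of the midpoint velocity, whose
        discrete gradient is all that remains of the convective term by
        \<open>s_h_axis\<close>.\<close>
      define q where "q = interior_prod D V2 (axis k 1) (midpoint_step u n)"
      let ?G = "dual_grad D V1 q"
      have e: "?e \<in> V1" by (rule axis_V1)
      have q: "q \<in> V2"
        unfolding q_def by (rule interior_prod_V2[OF mid])
      \<comment> \<open>The midpoint averages two iterates, each of which is orthogonal to
        \<open>?G\<close> by \<open>solenoidal\<close>.\<close>
      have "l2_inner D (midpoint_step u n) ?G =
          1 / 2 * (l2_inner D (u (Suc n)) ?G + l2_inner D (u n) ?G)"
        unfolding midpoint_step_def l2_inner_scaleR_left
        by (simp add: l2_inner_add_left L2(2) u dual_grad(1)[OF q])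
      then have "l2_inner D (midpoint_step u n) (s_h D V1 V2 (midpoint_step u n) ?e) = 0"
        using solenoidal[OF q] by (simp add: s_h_axis[OF mid mid, folded q_def] q_def[symmetric])
      then have "1 / \<Delta>t * (l2_inner D (u (n+1)) ?e - l2_inner D (u n) ?e) = 0"
        using assms(12)[rule_format, OF e, of n]
        unfolding step[OF e] stab[OF e] dual_grad_axis[OF p]
          l2_inner_eq_0_if_ae_eq_0(2)[OF dual_curl_axis]
        by linarith
      moreover have "l2_inner D (u m) ?e = (LINT x|dom_measure D. u m x) \<bullet> axis k 1" for m
        unfolding l2_inner_def
        by (rule integral_inner_left) (rule L2_integrable[OF D L2(2)[OF u]])
      ultimately show ?thesis
        using assms(6) by simp
    qed
    then show "(1/\<Delta>t) *\<^sub>R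
        ((LINT x|dom_measure D. u (n+1) x) - (LINT x|dom_measure D. u n x)) = 0"
      by (simp add: vec_eq_iff inner_axis)
  qed
qed

end
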